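(* Consider twisted $(2,n)$-crowns with radii $1$ and $a$ and masses $1$ and $m$ respectively, $n\ge3$. If $n\ge4$, assume that the equation $F(a)=0$ has exactly two positive solutions; in all cases let $z_1<z_2$ denote the two positive zeros of $F$. Then: 1. for $n=3$, $\mathcal{A}_2(3)\cap\mathcal{C}_3=\mathcal{A}_{2C}(3)$, that is, a twisted $(2,3)$-crown is convex if and only if $a$ belongs to the central admissible interval $\mathcal{A}_{2C}(3)$; 2. for $n=4$, $\mathcal{A}_2(4)\cap\mathcal{C}_4=\mathcal{C}_4$, that is, if the twisted $(2,4)$-crown is convex then $a$ belongs to the central admissible interval $\mathcal{A}_{2C}(4)$, but not all the values of $a$ within $\mathcal{A}_{2C}(4)$ correspond to convex configurations; 3. for $n\ge5$, if the twisted $(2,n)$-crown is convex, then $a$ belongs to the central admissible interval $\mathcal{A}_{2C}(n)$.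
   Context: Let $n\ge 2$ be an integer. For $a>0$ and $m>0$ consider $2n$ bodies in the plane $\mathbb{R}^2\cong\mathbb{C}$: $n$ bodies of mass $1$ at the points $e^{2\pi i k/n}$, $k=0,\dots,n-1$, and $n$ bodies of mass $m$ at the points $a\,e^{i(\pi/n+2\pi k/n)}$, $k=0,\dots,n-1$. The center of mass is at the origin. Configuration $(q_i)$ with masses $(\mu_i)$ is a central configuration if there is $\lambda\in\mathbb{R}$ such that $\nabla_{q_i}U+\lambda\mu_i q_i=0$ for all $i$, where $U=\sum_{i<j}\mu_i\mu_j/\|q_i-q_j\|$. If the configuration of $2n$ bodies consisting of $n$ bodies of mass $1$ at the points $e^{2\pi i k/n}$ and $n$ bodies of mass $m$ at the points $a\,e^{i(\pi/n+2\pi k/n)}$, $k=0,\dots,n-1$, is central, it is called a twisted $(2,n)$-crown with radius $a$ and mass ratio $m$. A value $a>0$ is admissible if there exists $m>0$ such that the configuration with parameters $(a,m)$ is a twisted $(2,n)$-crown; $\mathcal{A}_2(n)$ denotes the set of admissible values. Put $S_n=\frac14\sum_{k=1}^{n-1}\frac{1}{\sin(k\pi/n)}$, $\theta_k=(2k-1)\pi/n$, and $$C_{12}(a)=\sum_{k=1}^n\frac{1-a\cos\theta_k}{(1+a^2-2a\cos\theta_k)^{3/2}},\qquad C_{21}(a)=\sum_{k=1}^n\frac{a-\cos\theta_k}{(1+a^2-2a\cos\theta_k)^{3/2}},$$ $$F(a)=S_na-C_{21}(a),\qquad G(a)=S_n-a^3C_{12}(a),\qquad H(a)=a^2\frac{F(a)}{G(a)}.$$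 The configuration with parameters $(a,m)$ is a twisted $(2,n)$-crown if and only if $(C_{21}(a)-S_na)+\left(\frac{S_n}{a^2}-aC_{12}(a)\right)m=0$, that is, $m=H(a)$ when $G(a)\neq0$. For $n=3$ the equation $F(a)=0$ has exactly two positive solutions $z_1<z_2$, and $\mathcal{A}_2(3)=(0,z_1)\cup(1/z_2,z_2)\cup(1/z_1,\infty)$. For $n\ge4$, when $F$ has exactly two positive zeros $z_1<z_2$, $\mathcal{A}_2(n)=(0,1/z_2)\cup(z_1,1/z_1)\cup(z_2,\infty)$. The central admissible interval $\mathcal{A}_{2C}(n)$ is the one of these three intervals that contains $a=1$: $\mathcal{A}_{2C}(3)=(1/z_2,z_2)$, and $\mathcal{A}_{2C}(n)=(z_1,1/z_1)$ for $n\ge4$. A configuration is convex if every body is a vertex of the convex hull of all the bodies. For the $2n$ points $e^{2\pi i k/n}$ and $a\,e^{i(\pi/n+2\pi k/n)}$, $k=0,\dots,n-1$, with $n\ge3$, this holds if and only if $$a\in\mathcal{C}_n=\left(\cos\left(\frac{\pi}{n}\right),\frac{1}{\cos(\pi/n)}\right).$$ *)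

theory Defs
  imports "HOL-Analysis.Analysis"
begin

definition newton_potential ::
  "nat \<Rightarrow> (nat \<Rightarrow> real) \<Rightarrow> (nat \<Rightarrow> complex) \<Rightarrow> real" where
  "newton_potential N \<mu> q = (\<Sum>j<N. \<Sum>i<j. \<mu> i * \<mu> j / norm (q i - q j))"

text \<open>The gradient is taken in the real Euclidean structure of the complex plane. At a collision
  of bodies with nonzero masses it does not exist, so such configurations are not central.\<close>

definition central_configuration ::
  "nat \<Rightarrow> (nat \<Rightarrow> real) \<Rightarrow> (nat \<Rightarrow> complex) \<Rightarrow> bool" where
  "central_configuration N \<mu> q \<longleftrightarrow>
     (\<exists>l::real. \<forall>i<N. \<exists>g.
        (GDERIV (\<lambda>x. newton_potential N \<mu> (q(i := x))) (q i) :> g) \<and>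
        g + (l * \<mu> i) *\<^sub>R q i = 0)"

definition convex_configuration :: "nat \<Rightarrow> (nat \<Rightarrow> complex) \<Rightarrow> bool" where
  "convex_configuration N q \<longleftrightarrow>
     (\<forall>i<N. q i extreme_point_of (convex hull (q ` {..<N})))"

text \<open>Bodies \<open>0, \<dots>, n - 1\<close> form the regular polygon of radius \<open>1\<close>;
  bodies \<open>n, \<dots>, 2 * n - 1\<close> form the twisted polygon of radius \<open>a\<close>.\<close>

definition crown_position :: "nat \<Rightarrow> real \<Rightarrow> nat \<Rightarrow> complex" where
  "crown_position n a i =
     (if i < n then cis (2 * pi * real i / real n)
      else of_real a * cis (pi / real n + 2 * pi * real (i - n) / real n))"

definition crown_mass :: "nat \<Rightarrow> real \<Rightarrow> nat \<Rightarrow> real" where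
  "crown_mass n m i = (if i < n then 1 else m)"

definition twisted_crown :: "nat \<Rightarrow> real \<Rightarrow> real \<Rightarrow> bool" where
  "twisted_crown n a m \<longleftrightarrow>
     a > 0 \<and> m > 0 \<and> central_configuration (2 * n) (crown_mass n m) (crown_position n a)"

definition admissible :: "nat \<Rightarrow> real set" where
  "admissible n = {a. a > 0 \<and> (\<exists>m>0. twisted_crown n a m)}"

text \<open>For positive \<open>a\<close> and \<open>m\<close> the configuration is central iff
  \<open>crown_F n a = (crown_S n / a\<^sup>2 - a * C) * m\<close>, where \<open>C\<close> is the sum defining \<open>crown_C21\<close> with
  numerators \<open>1 - a * cos (crown_angle n k)\<close>. Admissibility of \<open>a\<close> amounts to positivity of
  \<open>crown_F n a * crown_F n (1 / a)\<close>, except where both factors vanish.\<close>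

definition crown_S :: "nat \<Rightarrow> real" where
  "crown_S n = (1 / 4) * (\<Sum>k = 1..n - 1. 1 / sin (real k * pi / real n))"

definition crown_angle :: "nat \<Rightarrow> nat \<Rightarrow> real" where
  "crown_angle n k = (2 * real k - 1) * pi / real n"

definition crown_C21 :: "nat \<Rightarrow> real \<Rightarrow> real" where
  "crown_C21 n a =
     (\<Sum>k = 1..n. (a - cos (crown_angle n k)) /
        (1 + a\<^sup>2 - 2 * a * cos (crown_angle n k)) powr (3 / 2))"

definition crown_F :: "nat \<Rightarrow> real \<Rightarrow> real" where
  "crown_F n a = crown_S n * a - crown_C21 n a"

definition crown_zeros :: "nat \<Rightarrow> real set" where
  "crown_zeros n = {a. a > 0 \<and> crown_F n a = 0}"

text \<open>When \<open>crown_F n\<close> has exactly two positive zeros, these are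
  \<open>crown_z1 n < crown_z2 n\<close>.\<close>

definition crown_z1 :: "nat \<Rightarrow> real" where
  "crown_z1 n = Min (crown_zeros n)"

definition crown_z2 :: "nat \<Rightarrow> real" where
  "crown_z2 n = Max (crown_zeros n)"

text \<open>The interval around \<open>1\<close> among those making up \<open>admissible n\<close>. For \<open>n = 3\<close> its end points
  come from the larger zero, because there \<open>crown_z1 n < 1 / crown_z2 n\<close>; for \<open>n \<ge> 4\<close>
  the order of these two numbers is reversed.\<close>

definition central_admissible :: "nat \<Rightarrow> real set" where
  "central_admissible n =
     (if n = 3 then {1 / crown_z2 n <..< crown_z2 n}
      else {crown_z1 n <..< 1 / crown_z1 n})"

text \<open>The radii \<open>a > 0\<close> for which \<open>crown_position n a\<close> is a convex configuration, if \<open>n \<ge> 3\<close>.\<close>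

definition convex_radii :: "nat \<Rightarrow> real set" where
  "convex_radii n = {cos (pi / real n) <..< 1 / cos (pi / real n)}"

end

theory Submission
  imports Defs
begin

text \<open>
  By the symmetries of the crown, the equations of a central configuration reduce to one real equation per
  ring, and eliminating the multiplier leaves a single one. With the substitution \<open>a \<mapsto> 1 / a\<close> it
  reads \<open>a * F a = m * F (1 / a)\<close> for \<open>F = crown_F n\<close> (lemma \<open>twisted_crown_iff\<close>). Hence \<open>a\<close> is admissible iff
  \<open>F a\<close> and \<open>F (1 / a)\<close> have the same sign or both vanish (\<open>admissible_iff\<close>). On the other hand a crown is
  convex iff neither ring reaches behind the edges of the other, that is, iff \<open>a\<close> and \<open>1 / a\<close> are both
  less than \<open>R = 1 / cos (pi / n)\<close> (\<open>convex_configuration_crown_iff\<close>). What remains is to locate the zeros of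
  \<open>F\<close> relative to \<open>1 / R\<close>, \<open>1\<close> and \<open>R\<close>.

  For \<open>n \<ge> 4\<close> the essential fact is \<open>F R < 0\<close> (\<open>crown_F_outer_bound_neg\<close>). At radius \<open>1\<close> both sums in \<open>F\<close> are
  sums of cosecants, one over the multiples of \<open>pi / n\<close> and the other over the points halfway between, and the
  convexity of the cosecant makes the second one larger. At radius \<open>R\<close> it loses at most
  a factor \<open>(cos (pi / n)) ^ 3\<close>; but the two nearest bodies contribute, up to this factor, four times the two
  outermost terms of the first sum, and this is enough.
  Since \<open>F\<close> is also positive near \<open>0\<close>, negative at \<open>1\<close> and positive for large radii, its two zeros satisfy
  \<open>z\<^sub>1 < 1 < R < z\<^sub>2\<close> (\<open>crown_zeros_two\<close>). So \<open>F a\<close> and \<open>F (1 / a)\<close> can have the same sign for a convex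
  radius \<open>a\<close> only if \<open>a\<close> and \<open>1 / a\<close> are both greater than \<open>z\<^sub>1\<close>, which is the central interval.
  For \<open>n = 4\<close> moreover \<open>F (1 / R) < 0\<close>, so that \<open>z\<^sub>1 < 1 / R\<close>: then every convex radius is admissible, and
  \<open>1 / R\<close> itself is a central radius without convexity.

  For \<open>n = 3\<close>, where \<open>R = 2\<close>, the sum in \<open>F\<close> has two distinct terms and can be treated by hand: on
  \<open>[1/2, 2]\<close> the function changes sign only once, from negative to positive, at the largest zero \<open>z\<^sub>2 > 1\<close>
  (\<open>crown_z2_3\<close>). So the convex admissible radii are those with \<open>a < z\<^sub>2\<close> and \<open>1 / a < z\<^sub>2\<close>.
\<close>

section \<open>Central configurations as balance of attractions\<close>

text \<open>The value at \<open>0\<close> is \<open>0\<close>, so a sum of attractions over all bodies may include the body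
  on which they act.\<close>
definition attraction :: "complex \<Rightarrow> complex" where
  "attraction z = z /\<^sub>R norm z ^ 3"

lemma attraction_0 [simp]: "attraction 0 = 0"
  by (simp add: attraction_def)

lemma attraction_cnj: "attraction (cnj z) = cnj (attraction z)"
  by (simp add: attraction_def)

text \<open>The inverse-square law commutes with rotations and scales with exponent \<open>- 2\<close>. This moves the
  equation of any body of a crown to the positive real axis, and relates radius \<open>a\<close> to \<open>1 / a\<close>.\<close>
lemma attraction_scale_rotate:
  assumes "r > 0"
  shows "attraction (of_real r * cis t * z) = of_real (1 / r\<^sup>2) * cis t * attraction z"
  using assms
  by (simp add: attraction_def norm_mult scaleR_conv_of_real power_mult_distrib
        power2_eq_square power3_eq_cube field_simps)

lemma GDERIV_pair_potential:
  fixes x p :: complex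
  assumes "x \<noteq> p"
  shows "GDERIV (\<lambda>x. c / norm (x - p)) x :> c *\<^sub>R attraction (p - x)"
proof -
  have "((\<lambda>x. x - p) has_derivative (\<lambda>h. h)) (at x)"
    by (auto intro!: derivative_eq_intros)
  then have "GDERIV (\<lambda>x. norm (x - p)) x :> sgn (x - p)"
    using has_derivative_compose[of "\<lambda>x. x - p" "\<lambda>h. h" x UNIV norm "\<lambda>h. inner h (sgn (x - p))"]
      has_derivative_norm[of "x - p"] assms
    by (simp add: gderiv_def)
  moreover have "DERIV (\<lambda>r. c / r) (norm (x - p)) :> - c / (norm (x - p))\<^sup>2"
    using assms by (auto intro!: derivative_eq_intros simp: power2_eq_square)
  ultimately have "GDERIV (\<lambda>x. c / norm (x - p)) x :> (- c / (norm (x - p))\<^sup>2) *\<^sub>R sgn (x - p)"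
    by (rule GDERIV_DERIV_compose)
  moreover have "(- c / (norm (x - p))\<^sup>2) *\<^sub>R sgn (x - p) = c *\<^sub>R attraction (p - x)"
    by (simp add: attraction_def sgn_div_norm norm_minus_commute power2_eq_square power3_eq_cube
        divide_inverse inverse_mult_distrib algebra_simps)
  ultimately show ?thesis by simp
qed

lemma GDERIV_sum:
  assumes "\<And>j. j \<in> A \<Longrightarrow> GDERIV (f j) x :> D j"
  shows "GDERIV (\<lambda>x. \<Sum>j\<in>A. f j x) x :> (\<Sum>j\<in>A. D j)"
  using assms unfolding gderiv_def inner_sum_right by (rule has_derivative_sum)

lemma GDERIV_unique:
  assumes "GDERIV f x :> D" "GDERIV f x :> D'"
  shows "D = D'"
proof -
  have "(\<lambda>h. inner h D) = (\<lambda>h. inner h D')"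
    using assms unfolding gderiv_def by (rule has_derivative_unique)
  then show ?thesis by (metis inner_commute vector_eq_ldot)
qed

text \<open>Only the pairs containing \<open>i\<close> depend on the position of body \<open>i\<close>. In the triangular sum these
  are the pairs \<open>k < i\<close> and the pairs \<open>i < j\<close>, which together run over all the other bodies.\<close>
lemma GDERIV_newton_potential:
  assumes i: "i < N" and inj: "\<And>j. j < N \<Longrightarrow> j \<noteq> i \<Longrightarrow> q j \<noteq> q i"
  shows "GDERIV (\<lambda>x. newton_potential N \<mu> (q(i := x))) (q i) :>
           \<mu> i *\<^sub>R (\<Sum>j<N. \<mu> j *\<^sub>R attraction (q j - q i))"
proof -
  define E where "E j = (\<mu> i * \<mu> j) *\<^sub>R attraction (q j - q i)" for j
  define T where "T k j = (if k = i then E j else if j = i then E k else 0)" for k j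
  have "GDERIV (\<lambda>x. \<mu> k * \<mu> j / norm ((q(i := x)) k - (q(i := x)) j)) (q i) :> T k j"
    if "k < j" "j < N" for k j
  proof -
    consider "k = i" "j \<noteq> i" | "k \<noteq> i" "j = i" | "k \<noteq> i" "j \<noteq> i"
      using \<open>k < j\<close> by linarith
    then show ?thesis
    proof cases
      case 1
      then show ?thesis
        using GDERIV_pair_potential[of "q i" "q j" "\<mu> i * \<mu> j"] inj[of j] that
        by (auto simp: T_def E_def)
    next
      case 2
      then show ?thesis
        using GDERIV_pair_potential[of "q i" "q k" "\<mu> i * \<mu> k"] inj[of k] that
        by (auto simp: T_def E_def norm_minus_commute mult.commute)
    next
      case 3
      then show ?thesis by (simp add: T_def GDERIV_const)
    qed
  qed
  then have "GDERIV (\<lambda>x. newton_potential N \<mu> (q(i := x))) (q i) :> (\<Sum>j<N. \<Sum>k<j. T k j)"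
    unfolding newton_potential_def by (intro GDERIV_sum) auto
  moreover have "(\<Sum>j<N. \<Sum>k<j. T k j) = (\<Sum>j<N. E j)"
  proof -
    have inner: "(\<Sum>k<j. T k j) = (if j = i then \<Sum>k<i. E k else if i < j then E j else 0)" for j
    proof (cases "j = i")
      case True
      then show ?thesis by (auto simp: T_def intro!: sum.cong)
    next
      case False
      then have "(\<Sum>k<j. T k j) = (\<Sum>k<j. if k = i then E j else 0)"
        unfolding T_def by (intro sum.cong) auto
      also have "\<dots> = (if i < j then E j else 0)"
        by (subst sum.delta) auto
      finally show ?thesis using False by simp
    qed
    have "(\<Sum>j<N. \<Sum>k<j. T k j) =
        (\<Sum>j<N. (if j = i then \<Sum>k<i. E k else 0) + (if i < j then E j else 0))"
      unfolding inner by (auto intro!: sum.cong)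
    also have "\<dots> = (\<Sum>k<i. E k) + (\<Sum>j<N. if i < j then E j else 0)"
      using i by (simp add: sum.distrib)
    also have "(\<Sum>k<i. E k) = (\<Sum>j<N. if j < i then E j else 0)"
      using i by (intro sum.mono_neutral_cong_left) auto
    also have "\<dots> + (\<Sum>j<N. if i < j then E j else 0) = (\<Sum>j<N. E j)"
      unfolding sum.distrib[symmetric] by (rule sum.cong) (auto simp: E_def)
    finally show ?thesis .
  qed
  ultimately show ?thesis
    by (simp add: E_def scaleR_sum_right)
qed

lemma central_configuration_iff:
  assumes "\<And>i j. i < N \<Longrightarrow> j < N \<Longrightarrow> j \<noteq> i \<Longrightarrow> q j \<noteq> q i" and "\<And>i. i < N \<Longrightarrow> \<mu> i > 0"
  shows "central_configuration N \<mu> q \<longleftrightarrow>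
    (\<exists>l. \<forall>i<N. (\<Sum>j<N. \<mu> j *\<^sub>R attraction (q j - q i)) + l *\<^sub>R q i = 0)"
proof -
  have "(\<exists>g. (GDERIV (\<lambda>x. newton_potential N \<mu> (q(i := x))) (q i) :> g) \<and> g + (l * \<mu> i) *\<^sub>R q i = 0)
      \<longleftrightarrow> (\<Sum>j<N. \<mu> j *\<^sub>R attraction (q j - q i)) + l *\<^sub>R q i = 0" if "i < N" for i l
  proof -
    let ?f = "\<Sum>j<N. \<mu> j *\<^sub>R attraction (q j - q i)"
    have G: "GDERIV (\<lambda>x. newton_potential N \<mu> (q(i := x))) (q i) :> \<mu> i *\<^sub>R ?f"
      using assms(1) that by (intro GDERIV_newton_potential) auto
    have "(\<exists>g. (GDERIV (\<lambda>x. newton_potential N \<mu> (q(i := x))) (q i) :> g) \<and> g + (l * \<mu> i) *\<^sub>R q i = 0)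
        \<longleftrightarrow> \<mu> i *\<^sub>R ?f + (l * \<mu> i) *\<^sub>R q i = 0"
      using G GDERIV_unique by blast
    also have "\<mu> i *\<^sub>R ?f + (l * \<mu> i) *\<^sub>R q i = \<mu> i *\<^sub>R (?f + l *\<^sub>R q i)"
      by (simp add: scaleR_add_right mult.commute)
    also have "\<mu> i *\<^sub>R (?f + l *\<^sub>R q i) = 0 \<longleftrightarrow> ?f + l *\<^sub>R q i = 0"
      using assms(2)[OF that] by simp
    finally show ?thesis .
  qed
  then show ?thesis
    unfolding central_configuration_def by (intro ex_cong1 all_cong1 imp_cong refl)
qed

lemma sum_lessThan_add:
  fixes h :: "nat \<Rightarrow> 'a::comm_monoid_add"
  shows "(\<Sum>j<n + k. h j) = (\<Sum>j<n. h j) + (\<Sum>j<k. h (n + j))"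
  by (induction k) (simp_all add: add.assoc)

text \<open>Rotating a regular polygon by one step permutes its vertices. Periodic functions on the integers
  express this without reducing indices modulo \<open>n\<close>.\<close>
lemma sum_periodic_shift:
  fixes f :: "int \<Rightarrow> 'a::ab_group_add"
  assumes per: "\<And>k. f (k + int n) = f k"
  shows "(\<Sum>j<n. f (int j + s)) = (\<Sum>j<n. f (int j))"
proof -
  have step: "(\<Sum>j<n. f (int j + (s + 1))) = (\<Sum>j<n. f (int j + s))" for s
  proof -
    have "f s + (\<Sum>j<n. f (int j + (s + 1))) = (\<Sum>j<Suc n. f (int j + s))"
      by (subst sum.lessThan_Suc_shift) (simp add: algebra_simps)
    also have "\<dots> = f s + (\<Sum>j<n. f (int j + s))"
      using per[of s] by (simp add: add.commute)
    finally show ?thesis by simp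
  qed
  show ?thesis
  proof (induction s rule: int_induct[where k = 0])
    case base
    then show ?case by simp
  next
    case (step1 s)
    then show ?case using step[of s] by simp
  next
    case (step2 s)
    then show ?case using step[of "s - 1"] by simp
  qed
qed

text \<open>The companion of the previous lemma for reflections of the polygon.\<close>
lemma sum_periodic_reflect:
  fixes f :: "int \<Rightarrow> 'a::ab_group_add"
  assumes per: "\<And>k. f (k + int n) = f k"
  shows "(\<Sum>j<n. f (s - int j)) = (\<Sum>j<n. f (int j))"
proof -
  have "(\<Sum>j<n. f (s - int j)) = (\<Sum>j<n. f (s - int (n - Suc j)))"
    by (rule sum.nat_diff_reindex[symmetric])
  also have "\<dots> = (\<Sum>j<n. f (int j + (s + 1 - int n)))"
    by (rule sum.cong) (auto simp: of_nat_diff algebra_simps)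
  also have "\<dots> = (\<Sum>j<n. f (int j))"
    using per by (rule sum_periodic_shift)
  finally show ?thesis .
qed

section \<open>Attraction exerted by a regular polygon\<close>

lemma powr_three_halves: "x \<ge> 0 \<Longrightarrow> x powr (3 / 2) = sqrt x ^ 3" for x :: real
  using powr_powr[of x "1/2" 3] by (simp add: powr_half_sqrt)

lemma norm_cis_diff_of_real:
  "norm (cis t - of_real a) = sqrt (1 + a\<^sup>2 - 2 * a * cos t)" for a t :: real
proof -
  have "(cos t - a)\<^sup>2 + (sin t)\<^sup>2 = 1 + a\<^sup>2 - 2 * a * cos t"
    using sin_cos_squared_add[of t] by (simp add: power2_eq_square algebra_simps)
  then show ?thesis by (simp add: cmod_def)
qed

lemma crown_denominator_nonneg: "1 + a\<^sup>2 - 2 * a * cos t \<ge> 0" for a t :: real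
proof -
  have "0 \<le> sqrt (1 + a\<^sup>2 - 2 * a * cos t)"
    unfolding norm_cis_diff_of_real[symmetric] by simp
  then show ?thesis by simp
qed

lemma Re_attraction_cis:
  "Re (attraction (cis t - of_real a)) =
     - ((a - cos t) / (1 + a\<^sup>2 - 2 * a * cos t) powr (3 / 2))"
proof -
  define D where "D = norm (cis t - of_real a)"
  have "(1 + a\<^sup>2 - 2 * a * cos t) powr (3 / 2) = D ^ 3"
    unfolding D_def norm_cis_diff_of_real by (rule powr_three_halves[OF crown_denominator_nonneg])
  moreover have "Re (attraction (cis t - of_real a)) = inverse (D ^ 3) * (cos t - a)"
    by (simp add: attraction_def D_def)
  moreover have "inverse (D ^ 3) * (cos t - a) = - ((a - cos t) / D ^ 3)"
    by (simp add: divide_inverse algebra_simps)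
  ultimately show ?thesis by simp
qed

lemma cis_int_period:
  assumes "n > 0"
  shows "cis (x + 2 * pi * of_int (k + int n) / real n) = cis (x + 2 * pi * of_int k / real n)"
proof -
  have "x + 2 * pi * of_int (k + int n) / real n = (x + 2 * pi * of_int k / real n) + 2 * pi"
    using assms by (simp add: field_simps)
  then show ?thesis by (simp only: cis_mult[symmetric] cis_2pi mult_1_right)
qed

text \<open>The reflection \<open>k \<mapsto> - k\<close> fixes the polygon and conjugates the attractions, so their sum is real.
  The real part follows from \<open>1 - cos (2 * x) = 2 * (sin x)\<^sup>2\<close>; the term \<open>j = 0\<close> vanishes on both sides
  because \<open>1 / sin 0 = 0\<close>.\<close>
lemma sum_attraction_ring:
  assumes "n > 0"
  shows "(\<Sum>j<n. attraction (cis (2 * pi * real j / real n) - 1)) = - of_real (crown_S n)"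
proof -
  define f where "f k = attraction (cis (0 + 2 * pi * of_int k / real n) - of_real 1)" for k :: int
  have per: "f (k + int n) = f k" for k
    unfolding f_def using assms by (simp only: cis_int_period)
  have f_minus: "f (0 - k) = cnj (f k)" for k
    by (simp add: f_def attraction_cnj[symmetric] cis_cnj del: of_real_1)
  have "(\<Sum>j<n. f (int j)) = (\<Sum>j<n. f (0 - int j))"
    by (rule sum_periodic_reflect[symmetric]) (rule per)
  also have "\<dots> = cnj (\<Sum>j<n. f (int j))"
    unfolding f_minus by simp
  finally have "Im (\<Sum>j<n. f (int j)) = 0"
    by (metis Reals_cnj_iff complex_is_Real_iff)
  moreover have "Re (f (int j)) = - (1 / 4) * (1 / sin (real j * pi / real n))" if "j < n" for j
  proof -
    define x where "x = real j * pi / real n"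
    have "x \<ge> 0" "x \<le> pi" using that by (auto simp: x_def field_simps)
    then have s: "sin x \<ge> 0" by (rule sin_ge_zero)
    have c: "cos (2 * x) = 1 - 2 * (sin x)\<^sup>2" by (simp add: cos_double_sin)
    have "1 + 1\<^sup>2 - 2 * 1 * cos (2 * x) = (2 * sin x)\<^sup>2"
      by (simp add: c power2_eq_square)
    then have "(1 + 1\<^sup>2 - 2 * 1 * cos (2 * x)) powr (3 / 2) = (2 * sin x) ^ 3"
      using s by (simp only: powr_three_halves[OF zero_le_power2] real_sqrt_abs)
    then have "Re (attraction (cis (2 * x) - of_real 1)) = - ((1 - cos (2 * x)) / (2 * sin x) ^ 3)"
      unfolding Re_attraction_cis by simp
    also have "\<dots> = - (1 / 4) * (1 / sin x)"
      by (simp add: c power2_eq_square power3_eq_cube)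
    finally show ?thesis by (simp add: f_def x_def mult.commute mult.left_commute)
  qed
  then have "Re (\<Sum>j<n. f (int j)) = - (1 / 4) * (\<Sum>j<n. 1 / sin (real j * pi / real n))"
    unfolding sum_distrib_left by simp
  moreover have "(\<Sum>j<n. 1 / sin (real j * pi / real n)) = (\<Sum>k=1..n - 1. 1 / sin (real k * pi / real n))"
    using assms by (intro sum.mono_neutral_right) (auto simp: not_le)
  ultimately have "(\<Sum>j<n. f (int j)) = - of_real (crown_S n)"
    by (simp add: complex_eq_iff crown_S_def)
  then show ?thesis by (simp add: f_def)
qed

text \<open>Here the symmetry of the polygon about the real axis is \<open>k \<mapsto> 1 - k\<close>.\<close>
lemma sum_attraction_twisted_ring:
  assumes "n > 0"
  shows "(\<Sum>j<n. attraction (cis ((2 * real j - 1) * pi / real n) - of_real a)) =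
           - of_real (crown_C21 n a)"
proof -
  define f where "f k = attraction (cis (- pi / real n + 2 * pi * of_int k / real n) - of_real a)" for k :: int
  have per: "f (k + int n) = f k" for k
    unfolding f_def using assms by (simp only: cis_int_period)
  have f: "f (int j) = attraction (cis ((2 * real j - 1) * pi / real n) - of_real a)" for j
    by (simp add: f_def add_divide_distrib diff_divide_distrib algebra_simps)
  have arg: "- (- pi / real n + 2 * pi * of_int k / real n) = - pi / real n + 2 * pi * of_int (1 - k) / real n" for k
    using assms by (simp add: field_simps)
  have f_minus: "f (1 - k) = cnj (f k)" for k
    unfolding f_def attraction_cnj[symmetric] complex_cnj_diff cis_cnj complex_cnj_complex_of_real arg ..
  have "(\<Sum>j<n. f (int j)) = (\<Sum>j<n. f (1 - int j))"
    by (rule sum_periodic_reflect[symmetric]) (rule per)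
  also have "\<dots> = cnj (\<Sum>j<n. f (int j))"
    unfolding f_minus by simp
  finally have "Im (\<Sum>j<n. f (int j)) = 0"
    by (metis Reals_cnj_iff complex_is_Real_iff)
  moreover have "Re (\<Sum>j<n. f (int j)) = - crown_C21 n a"
  proof -
    have "(\<Sum>j<n. f (int j)) = (\<Sum>j<n. f (int j + 1))"
      by (rule sum_periodic_shift[symmetric]) (rule per)
    also have "\<dots> = (\<Sum>k=1..n. f (int k))"
      by (rule sum.reindex_bij_witness[of _ "\<lambda>k. k - 1" Suc]) (auto simp: add.commute)
    finally have "Re (\<Sum>j<n. f (int j)) = (\<Sum>k=1..n. Re (f (int k)))"
      by simp
    also have "\<dots> = - crown_C21 n a"
      unfolding f Re_attraction_cis crown_C21_def crown_angle_def by (simp add: sum_negf)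
    finally show ?thesis .
  qed
  ultimately show ?thesis unfolding f[symmetric] by (simp add: complex_eq_iff)
qed

section \<open>Separation of the bodies of a crown\<close>

lemma cos_le_cos_between:
  assumes "0 \<le> \<alpha>" "\<alpha> \<le> x" "x \<le> 2 * pi - \<alpha>"
  shows "cos x \<le> cos \<alpha>"
proof (cases "x \<le> pi")
  case True
  then show ?thesis using assms by (intro cos_monotone_0_pi_le) auto
next
  case False
  then have "cos (2 * pi - x) \<le> cos \<alpha>"
    using assms by (intro cos_monotone_0_pi_le) auto
  then show ?thesis by (simp add: cos_diff)
qed

lemma cos_multiple_le:
  assumes "n > 0" "0 \<le> c" "c \<le> \<bar>p\<bar>" "\<bar>p\<bar> \<le> 2 * real n - c"
  shows "cos (p * pi / real n) \<le> cos (c * pi / real n)"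
proof -
  have "cos (p * pi / real n) = cos \<bar>p * pi / real n\<bar>" by (simp only: cos_abs_real)
  also have "\<bar>p * pi / real n\<bar> = \<bar>p\<bar> * pi / real n" by (simp add: abs_mult)
  also have "cos \<dots> \<le> cos (c * pi / real n)"
  proof (rule cos_le_cos_between)
    have "\<bar>p\<bar> * pi / real n \<le> (2 * real n - c) * pi / real n"
      using assms by (intro divide_right_mono mult_right_mono) auto
    also have "\<dots> = 2 * pi - c * pi / real n"
      using assms(1) by (simp add: field_simps)
    finally show "\<bar>p\<bar> * pi / real n \<le> 2 * pi - c * pi / real n" .
  qed (use assms in \<open>auto intro!: divide_right_mono mult_right_mono\<close>)
  finally show ?thesis .
qed

text \<open>Two vertices of one ring differ in angle by an even multiple of \<open>pi / n\<close> strictly between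
  \<open>- 2 * pi\<close> and \<open>2 * pi\<close>, vertices of different rings by an odd one. Both facts serve twice: they exclude
  collisions, and they provide the supporting lines that show convexity.\<close>
lemma cos_same_ring_less:
  assumes "i < n" "j < n" "i \<noteq> j"
  shows "cos (2 * pi * real j / real n - 2 * pi * real i / real n) < 1"
proof -
  define p where "p = 2 * (int j - int i)"
  have n: "n \<ge> 2" using assms by linarith
  have p: "\<bar>p\<bar> \<ge> 2" "\<bar>p\<bar> \<le> 2 * int n - 2" using assms by (auto simp: p_def)
  have p': "real_of_int \<bar>p\<bar> \<ge> 2" "real_of_int \<bar>p\<bar> \<le> 2 * real n - 2"
    using p by linarith+
  have "cos (of_int p * pi / real n) \<le> cos (2 * pi / real n)"
    using n p' by (intro cos_multiple_le) auto
  also have "\<dots> < cos 0"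
    using n by (intro cos_monotone_0_pi) (simp_all add: field_simps)
  finally show ?thesis
    by (simp add: p_def diff_divide_distrib algebra_simps)
qed

lemma cos_other_ring_le:
  assumes "i < n" "j < n"
  shows "cos (pi / real n + 2 * pi * real j / real n - 2 * pi * real i / real n) \<le> cos (pi / real n)"
proof -
  define p where "p = 2 * (int j - int i) + 1"
  have "p \<noteq> 0" unfolding p_def by presburger
  then have p: "\<bar>p\<bar> \<ge> 1" "\<bar>p\<bar> \<le> 2 * int n - 1" using assms by (auto simp: p_def)
  have p': "real_of_int \<bar>p\<bar> \<ge> 1" "real_of_int \<bar>p\<bar> \<le> 2 * real n - 1"
    using p by linarith+
  have "cos (of_int p * pi / real n) \<le> cos (1 * pi / real n)"
    using assms p' by (intro cos_multiple_le) auto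
  then show ?thesis
    by (simp add: p_def diff_divide_distrib add_divide_distrib algebra_simps)
qed

lemma cos_pi_over_less_1: "n \<ge> 1 \<Longrightarrow> cos (pi / real n) < 1"
  using cos_monotone_0_pi[of 0 "pi / real n"] by (simp add: field_simps)

lemma inner_cis: "inner (cis s) (cis t) = cos (s - t)"
  by (simp add: inner_complex_def cos_diff)

lemma inner_of_real_mult: "inner (of_real a * z) w = a * inner z w"
     "inner z (of_real a * w) = a * inner z w" for z w :: complex
  by (simp_all flip: scaleR_conv_of_real)

lemma crown_position_inner:
  assumes "i < n" shows "crown_position n a i = cis (2 * pi * real i / real n)"
  using assms by (simp add: crown_position_def)

lemma crown_position_outer:
  "crown_position n a (n + i) = of_real a * cis (pi / real n + 2 * pi * real i / real n)"
  by (simp add: crown_position_def)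

text \<open>Bodies never collide, whatever the radius: bodies of different rings could only meet if
  \<open>a = 1\<close>, and then their directions differ.\<close>
lemma crown_position_inj:
  assumes "n \<ge> 2" "a > 0" "i < 2 * n" "j < 2 * n" "i \<noteq> j"
  shows "crown_position n a i \<noteq> crown_position n a j"
proof -
  have mixed: False
    if "i < n" "j < n" and eq: "crown_position n a i = crown_position n a (n + j)" for i j
  proof -
    have eq': "cis (2 * pi * real i / real n) = of_real a * cis (pi / real n + 2 * pi * real j / real n)"
      using eq that by (simp add: crown_position_inner crown_position_outer)
    have "norm (cis (2 * pi * real i / real n)) = norm (of_real a * cis (pi / real n + 2 * pi * real j / real n))"
      unfolding eq' ..
    then have "a = 1" using \<open>a > 0\<close> by (simp add: norm_mult)
    then have "inner (cis (pi / real n + 2 * pi * real j / real n)) (cis (2 * pi * real i / real n)) = 1"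
      using eq' by (simp add: inner_cis)
    then show False
      using cos_other_ring_le[OF that(1,2)] cos_pi_over_less_1[of n] assms(1) by (simp add: inner_cis)
  qed
  have same: False
    if "i < n" "j < n" "i \<noteq> j" "cis (x + 2 * pi * real i / real n) = cis (x + 2 * pi * real j / real n)" for i j x
  proof -
    have "inner (cis (x + 2 * pi * real j / real n)) (cis (x + 2 * pi * real i / real n)) = 1"
      using that(4) by (simp add: inner_cis)
    then show False
      using cos_same_ring_less[OF that(1,2,3)] by (simp add: inner_cis)
  qed
  consider "i < n" "j < n" | "i < n" "j \<ge> n" | "i \<ge> n" "j < n" | "i \<ge> n" "j \<ge> n"
    by linarith
  then show ?thesis
  proof cases
    case 1
    then show ?thesis using same[of i j 0] assms(5) by (auto simp: crown_position_inner)
  next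
    case 2
    then show ?thesis using mixed[of i "j - n"] assms by (auto simp: less_diff_conv2)
  next
    case 3
    then show ?thesis using mixed[of j "i - n"] assms by (auto simp: less_diff_conv2)
  next
    case 4
    then have "i - n < n" "j - n < n" "i - n \<noteq> j - n" using assms by auto
    moreover have "crown_position n a i = of_real a * cis (pi / real n + 2 * pi * real (i - n) / real n)"
      "crown_position n a j = of_real a * cis (pi / real n + 2 * pi * real (j - n) / real n)"
      using 4 by (simp_all add: crown_position_def)
    ultimately show ?thesis
      using same[of "i - n" "j - n" "pi / real n"] \<open>a > 0\<close> by fastforce
  qed
qed

section \<open>The crown equation\<close>

text \<open>After division by \<open>q\<^sub>i\<close>, the attraction of the own ring is that of the regular polygon on its
  vertex \<open>1\<close>. The other ring, rescaled by \<open>1 / a\<close>, becomes the unit polygon acting on the point \<open>1 / a\<close>;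
  this is why only the sum \<open>crown_C21\<close> occurs.\<close>
lemma attraction_on_inner_body:
  assumes "i < n" "a > 0"
  shows "(\<Sum>j<2 * n. crown_mass n m j *\<^sub>R attraction (crown_position n a j - crown_position n a i)) =
    - of_real (crown_S n + m / a\<^sup>2 * crown_C21 n (1 / a)) * crown_position n a i"
proof -
  have n: "n > 0" using assms by simp
  define w where "w = cis (2 * pi * real i / real n)"
  define f where "f k = attraction (cis (0 + 2 * pi * of_int k / real n) - 1)" for k :: int
  define g where "g k = attraction (cis (- pi / real n + 2 * pi * of_int k / real n) - of_real (1 / a))" for k :: int
  have per: "f (k + int n) = f k" "g (k + int n) = g k" for k
    unfolding f_def g_def using n by (simp_all only: cis_int_period)
  have pos: "crown_position n a i = w"
    using assms(1) by (simp add: crown_position_inner w_def)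
  have inner: "attraction (crown_position n a j - crown_position n a i) = w * f (int j + - int i)" if "j < n" for j
  proof -
    have "cis (2 * pi * real j / real n) = w * cis (0 + 2 * pi * of_int (int j + - int i) / real n)"
      by (simp add: w_def cis_mult diff_divide_distrib algebra_simps)
    then have "crown_position n a j - crown_position n a i =
        of_real 1 * w * (cis (0 + 2 * pi * of_int (int j + - int i) / real n) - 1)"
      using that by (simp add: pos crown_position_inner right_diff_distrib)
    then show ?thesis
      unfolding w_def f_def using attraction_scale_rotate[of 1] by simp
  qed
  have outer: "attraction (crown_position n a (n + j) - crown_position n a i) =
      of_real (1 / a\<^sup>2) * w * g (int j + (1 - int i))" for j
  proof -
    have "cis (pi / real n + 2 * pi * real j / real n) =
        w * cis (- pi / real n + 2 * pi * of_int (int j + (1 - int i)) / real n)"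
      by (simp add: w_def cis_mult diff_divide_distrib add_divide_distrib algebra_simps)
    then have "crown_position n a (n + j) - crown_position n a i =
        of_real a * w * (cis (- pi / real n + 2 * pi * of_int (int j + (1 - int i)) / real n) - of_real (1 / a))"
      using assms(2) by (simp add: pos crown_position_outer right_diff_distrib)
    then show ?thesis
      unfolding w_def g_def using attraction_scale_rotate[OF assms(2)] by simp
  qed
  have "(\<Sum>j<n. f (int j + - int i)) = (\<Sum>j<n. f (int j))"
    by (rule sum_periodic_shift) (rule per)
  also have "\<dots> = - of_real (crown_S n)"
    using sum_attraction_ring[OF n] by (simp add: f_def)
  finally have sf: "(\<Sum>j<n. f (int j + - int i)) = - of_real (crown_S n)" .
  have "(\<Sum>j<n. g (int j + (1 - int i))) = (\<Sum>j<n. g (int j))"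
    by (rule sum_periodic_shift) (rule per)
  also have "\<dots> = - of_real (crown_C21 n (1 / a))"
    unfolding sum_attraction_twisted_ring[OF n, symmetric] g_def
    by (simp add: diff_divide_distrib algebra_simps)
  finally have sg: "(\<Sum>j<n. g (int j + (1 - int i))) = - of_real (crown_C21 n (1 / a))" .
  have "(\<Sum>j<2 * n. crown_mass n m j *\<^sub>R attraction (crown_position n a j - crown_position n a i))
     = (\<Sum>j<n. w * f (int j + - int i)) + (\<Sum>j<n. m *\<^sub>R (of_real (1 / a\<^sup>2) * w * g (int j + (1 - int i))))"
    unfolding mult_2 sum_lessThan_add outer by (simp add: crown_mass_def inner)
  also have "\<dots> = w * (\<Sum>j<n. f (int j + - int i)) + of_real (m / a\<^sup>2) * w * (\<Sum>j<n. g (int j + (1 - int i)))"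
    by (simp add: sum_distrib_left scaleR_conv_of_real mult.assoc)
  also have "\<dots> = - of_real (crown_S n + m / a\<^sup>2 * crown_C21 n (1 / a)) * crown_position n a i"
    unfolding sf sg pos by (simp add: algebra_simps)
  finally show ?thesis .
qed

lemma attraction_on_outer_body:
  assumes "i < n" "a > 0"
  shows "(\<Sum>j<2 * n. crown_mass n m j *\<^sub>R attraction (crown_position n a j - crown_position n a (n + i))) =
    - of_real ((crown_C21 n a + m / a\<^sup>2 * crown_S n) / a) * crown_position n a (n + i)"
proof -
  have n: "n > 0" using assms by simp
  define w where "w = cis (pi / real n + 2 * pi * real i / real n)"
  define f where "f k = attraction (cis (0 + 2 * pi * of_int k / real n) - 1)" for k :: int
  define g where "g k = attraction (cis (- pi / real n + 2 * pi * of_int k / real n) - of_real a)" for k :: int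
  have per: "f (k + int n) = f k" "g (k + int n) = g k" for k
    unfolding f_def g_def using n by (simp_all only: cis_int_period)
  have pos: "crown_position n a (n + i) = of_real a * w"
    by (simp add: crown_position_outer w_def)
  have inner: "attraction (crown_position n a j - crown_position n a (n + i)) = w * g (int j + - int i)" if "j < n" for j
  proof -
    have "cis (2 * pi * real j / real n) = w * cis (- pi / real n + 2 * pi * of_int (int j + - int i) / real n)"
      by (simp add: w_def cis_mult diff_divide_distrib algebra_simps)
    then have "crown_position n a j - crown_position n a (n + i) =
        of_real 1 * w * (cis (- pi / real n + 2 * pi * of_int (int j + - int i) / real n) - of_real a)"
      using that by (simp add: pos crown_position_inner right_diff_distrib)
    then show ?thesis
      unfolding w_def g_def using attraction_scale_rotate[of 1] by simp
  qed
  have outer: "attraction (crown_position n a (n + j) - crown_position n a (n + i)) =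
      of_real (1 / a\<^sup>2) * w * f (int j + - int i)" for j
  proof -
    have "cis (pi / real n + 2 * pi * real j / real n) =
        w * cis (0 + 2 * pi * of_int (int j + - int i) / real n)"
      by (simp add: w_def cis_mult diff_divide_distrib algebra_simps)
    then have "crown_position n a (n + j) =
        of_real a * (w * cis (0 + 2 * pi * of_int (int j + - int i) / real n))"
      by (simp only: crown_position_outer)
    then have "crown_position n a (n + j) - crown_position n a (n + i) =
        of_real a * w * (cis (0 + 2 * pi * of_int (int j + - int i) / real n) - 1)"
      by (simp add: pos right_diff_distrib mult.assoc)
    then show ?thesis
      unfolding w_def f_def using attraction_scale_rotate[OF assms(2)] by simp
  qed
  have "(\<Sum>j<n. f (int j + - int i)) = (\<Sum>j<n. f (int j))"
    by (rule sum_periodic_shift) (rule per)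
  also have "\<dots> = - of_real (crown_S n)"
    using sum_attraction_ring[OF n] by (simp add: f_def)
  finally have sf: "(\<Sum>j<n. f (int j + - int i)) = - of_real (crown_S n)" .
  have "(\<Sum>j<n. g (int j + - int i)) = (\<Sum>j<n. g (int j))"
    by (rule sum_periodic_shift) (rule per)
  also have "\<dots> = - of_real (crown_C21 n a)"
    unfolding sum_attraction_twisted_ring[OF n, symmetric] g_def
    by (simp add: diff_divide_distrib algebra_simps)
  finally have sg: "(\<Sum>j<n. g (int j + - int i)) = - of_real (crown_C21 n a)" .
  have "(\<Sum>j<2 * n. crown_mass n m j *\<^sub>R attraction (crown_position n a j - crown_position n a (n + i)))
     = (\<Sum>j<n. w * g (int j + - int i)) + (\<Sum>j<n. m *\<^sub>R (of_real (1 / a\<^sup>2) * w * f (int j + - int i)))"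
    unfolding mult_2 sum_lessThan_add outer by (simp add: crown_mass_def inner)
  also have "\<dots> = w * (\<Sum>j<n. g (int j + - int i)) + of_real (m / a\<^sup>2) * w * (\<Sum>j<n. f (int j + - int i))"
    by (simp add: sum_distrib_left scaleR_conv_of_real mult.assoc)
  also have "\<dots> = - of_real ((crown_C21 n a + m / a\<^sup>2 * crown_S n) / a) * (of_real a * w)"
    unfolding sf sg using assms(2) by (simp add: field_simps)
  finally show ?thesis unfolding pos .
qed

text \<open>The attraction on each body is a multiple of its position, by a factor depending only on its ring. So the
  configuration is central iff the two factors agree, and the difference of the factors, times \<open>a\<^sup>2\<close>, is
  the difference of the two sides of the equation.\<close>
lemma twisted_crown_iff:
  assumes "n \<ge> 2"
  shows "twisted_crown n a m \<longleftrightarrow> a > 0 \<and> m > 0 \<and> a * crown_F n a = m * crown_F n (1 / a)"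
proof (cases "a > 0 \<and> m > 0")
  case True
  then have a: "a > 0" and m: "m > 0" by auto
  define P where "P = crown_S n + m / a\<^sup>2 * crown_C21 n (1 / a)"
  define Q where "Q = (crown_C21 n a + m / a\<^sup>2 * crown_S n) / a"
  have body: "(\<Sum>j<2 * n. crown_mass n m j *\<^sub>R attraction (crown_position n a j - crown_position n a i)) +
      l *\<^sub>R crown_position n a i = 0 \<longleftrightarrow> l = (if i < n then P else Q)" if "i < 2 * n" for i l
  proof -
    have nz: "crown_position n a i \<noteq> 0" using a by (simp add: crown_position_def)
    have "(\<Sum>j<2 * n. crown_mass n m j *\<^sub>R attraction (crown_position n a j - crown_position n a i)) =
        - of_real (if i < n then P else Q) * crown_position n a i"
    proof (cases "i < n")
      case True
      then show ?thesis using attraction_on_inner_body[OF True a] by (simp add: P_def)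
    next
      case False
      then have "i - n < n" "n + (i - n) = i" using that by auto
      then show ?thesis using attraction_on_outer_body[of "i - n" n a m] a False by (simp add: Q_def)
    qed
    then show ?thesis
      using nz by (simp add: scaleR_conv_of_real flip: distrib_right of_real_minus of_real_add)
  qed
  have "central_configuration (2 * n) (crown_mass n m) (crown_position n a) \<longleftrightarrow>
      (\<exists>l. \<forall>i<2 * n. l = (if i < n then P else Q))"
    by (subst central_configuration_iff)
       (use assms a m crown_position_inj body in \<open>auto simp: crown_mass_def\<close>)
  also have "\<dots> \<longleftrightarrow> P = Q"
  proof
    assume "\<exists>l. \<forall>i<2 * n. l = (if i < n then P else Q)"
    then obtain l where "\<And>i. i < 2 * n \<Longrightarrow> l = (if i < n then P else Q)" by blast
    from this[of 0] this[of n] show "P = Q" using assms by simp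
  qed auto
  also have "\<dots> \<longleftrightarrow> a * crown_F n a = m * crown_F n (1 / a)"
  proof -
    have "a * crown_F n a - m * crown_F n (1 / a) = a\<^sup>2 * (P - Q)"
      using a by (simp add: P_def Q_def crown_F_def power2_eq_square field_simps)
    then show ?thesis using a by auto
  qed
  finally show ?thesis using True by (simp add: twisted_crown_def)
qed (auto simp: twisted_crown_def)

lemma admissible_iff:
  assumes "n \<ge> 2"
  shows "a \<in> admissible n \<longleftrightarrow> a > 0 \<and>
    (crown_F n a * crown_F n (1 / a) > 0 \<or> crown_F n a = 0 \<and> crown_F n (1 / a) = 0)"
proof (cases "a > 0")
  case True
  define x y where "x = crown_F n a" and "y = crown_F n (1 / a)"
  have "(\<exists>m>0. a * x = m * y) \<longleftrightarrow> x * y > 0 \<or> x = 0 \<and> y = 0"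
  proof
    assume "\<exists>m>0. a * x = m * y"
    then obtain m where "m > 0" and m: "x = (m / a) * y"
      using True by (auto simp: field_simps)
    have xy: "x * y = (m / a) * y\<^sup>2" by (simp add: m power2_eq_square)
    then show "x * y > 0 \<or> x = 0 \<and> y = 0"
      unfolding xy using True \<open>m > 0\<close> by (cases "y = 0") (simp_all add: m)
  next
    assume "x * y > 0 \<or> x = 0 \<and> y = 0"
    then show "\<exists>m>0. a * x = m * y"
    proof
      assume "x * y > 0"
      then show ?thesis
        using True by (intro exI[of _ "a * x / y"]) (auto simp: zero_less_mult_iff divide_neg_neg mult_pos_neg)
    qed (auto intro: exI[of _ 1])
  qed
  then show ?thesis
    using True by (simp add: admissible_def twisted_crown_iff[OF assms] x_def y_def)
qed (auto simp: admissible_def)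

section \<open>Convexity of a crown\<close>

lemma extreme_point_of_convex_hull_supporting:
  fixes x u :: "'a::euclidean_space"
  assumes "finite T" "x \<in> T" and "\<And>y. y \<in> T \<Longrightarrow> y \<noteq> x \<Longrightarrow> inner u y < inner u x"
  shows "x extreme_point_of (convex hull T)"
proof -
  have "convex hull (T - {x}) \<subseteq> {y. inner u y < inner u x}"
    using assms by (intro hull_minimal convex_halfspace_lt) auto
  then have "x extreme_point_of (convex hull (insert x (T - {x})))"
    using assms(1) by (intro extreme_point_of_convex_hull_insert) auto
  then show ?thesis using assms(2) by (simp add: insert_absorb)
qed

lemma not_extreme_point_of_convex_hull:
  fixes x :: "'a::euclidean_space"
  assumes "x \<in> convex hull S" "S \<subseteq> T" "x \<notin> S"
  shows "\<not> x extreme_point_of (convex hull T)"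
proof
  assume x: "x extreme_point_of (convex hull T)"
  have "convex hull S \<subseteq> convex hull T" using assms(2) by (rule hull_mono)
  with x assms(1) have "x extreme_point_of (convex hull S)"
    by (auto simp: extreme_point_of_def)
  then show False using assms(3) extreme_point_of_convex_hull by blast
qed

lemma sum_cis_arithmetic:
  assumes "cis t \<noteq> 1" "cis (real n * t) = 1"
  shows "(\<Sum>j<n. cis (x + real j * t)) = 0"
proof -
  have "cis t ^ n = 1" using assms(2) by (simp add: Complex.DeMoivre)
  then have "(\<Sum>j<n. cis t ^ j) = 0" using assms(1) by (simp add: geometric_sum)
  moreover have "cis (x + real j * t) = cis x * cis t ^ j" for j
    by (simp add: Complex.DeMoivre cis_mult)
  ultimately show ?thesis by (simp add: sum_distrib_left[symmetric])
qed

lemma cos_2pi_over_less_1: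
  assumes "n \<ge> 2"
  shows "cos (2 * pi / real n) < 1"
  using assms cos_same_ring_less[of 0 n 1] by simp

lemma sum_regular_polygon:
  assumes "n \<ge> 2"
  shows "(\<Sum>j<n. cis (x + 2 * pi * real j / real n)) = 0"
proof -
  have "cis (2 * pi / real n) \<noteq> 1"
    using cos_2pi_over_less_1[OF assms] by (auto simp: complex_eq_iff)
  moreover have "cis (real n * (2 * pi / real n)) = 1" using assms by simp
  ultimately show ?thesis
    using sum_cis_arithmetic[of "2 * pi / real n" n x] by (simp add: mult.commute)
qed

text \<open>The centre of the polygon lies in its hull, as the mean of the vertices. So does the segment
  from the centre to the midpoint of any two vertices.\<close>
lemma scaled_midpoint_in_regular_polygon:
  fixes r x t :: real
  assumes "n \<ge> 2" and "0 \<le> t" "t \<le> 1" and "i < n" "j < n"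
  defines "P \<equiv> (\<lambda>j. of_real r * cis (x + 2 * pi * real j / real n)) ` {..<n}"
  shows "t *\<^sub>R ((1/2) *\<^sub>R (of_real r * cis (x + 2 * pi * real i / real n)) +
           (1/2) *\<^sub>R (of_real r * cis (x + 2 * pi * real j / real n))) \<in> convex hull P"
proof -
  let ?q = "\<lambda>j. of_real r * cis (x + 2 * pi * real j / real n)"
  have q: "?q j \<in> convex hull P" if "j < n" for j
    unfolding P_def using that by (intro hull_inc) auto
  have "(\<Sum>j<n. (1 / real n) *\<^sub>R ?q j) \<in> convex hull P"
    using assms(1) q by (intro convex_sum) auto
  moreover have "(\<Sum>j<n. (1 / real n) *\<^sub>R ?q j) = 0"
    using sum_regular_polygon[OF assms(1), of x]
    by (simp add: scaleR_sum_right[symmetric] sum_distrib_left[symmetric])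
  ultimately have zero: "0 \<in> convex hull P" by simp
  have "(1/2) *\<^sub>R ?q i + (1/2) *\<^sub>R ?q j \<in> convex hull P"
    by (rule convexD[OF convex_convex_hull q q]) (use assms in auto)
  then have "t *\<^sub>R ((1/2) *\<^sub>R ?q i + (1/2) *\<^sub>R ?q j) + (1 - t) *\<^sub>R 0 \<in> convex hull P"
    by (rule convexD[OF convex_convex_hull _ zero]) (use assms in auto)
  then show ?thesis by simp
qed

lemma cis_add_cis_minus: "cis (x + y) + cis (x - y) = of_real (2 * cos y) * cis x"
  by (simp add: complex_eq_iff cos_add cos_diff sin_add sin_diff)

lemma cos_pi_over_pos: "n \<ge> 3 \<Longrightarrow> cos (pi / real n) > 0"
  by (intro cos_gt_zero_pi) (simp_all add: field_simps less_le_trans[of _ 0])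

text \<open>An edge of a ring of radius \<open>r\<close> has distance \<open>r * cos (pi / n)\<close> from the origin, in the direction
  of a body of the other ring. If that body has at most this distance, it lies in the hull of the ring and is
  not extreme. If neither ring has such a body, then the line through any body perpendicular to its
  position vector supports the configuration, and the body is extreme.\<close>
lemma convex_configuration_crown_iff:
  assumes n: "n \<ge> 3" and a: "a > 0"
  shows "convex_configuration (2 * n) (crown_position n a) \<longleftrightarrow> a \<in> convex_radii n"
proof
  let ?q = "crown_position n a" and ?c = "cos (pi / real n)"
  let ?T = "?q ` {..<2 * n}"
  have c: "0 < ?c" "?c < 1" using cos_pi_over_pos[OF n] cos_pi_over_less_1[of n] n by auto
  have inj: "?q i = ?q j \<longleftrightarrow> i = j" if "i < 2 * n" "j < 2 * n" for i j
    using crown_position_inj[of n a i j] that n a by auto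
  {
    assume conv: "convex_configuration (2 * n) ?q"
    have "?c < a"
    proof (rule ccontr)
      assume "\<not> ?c < a"
      let ?P = "(\<lambda>j. of_real 1 * cis (0 + 2 * pi * real j / real n)) ` {..<n}"
      have P: "?P = ?q ` {..<n}"
        by (intro image_cong) (simp_all add: crown_position_inner)
      \<comment> \<open>\<open>?c\<close> times the direction of body \<open>n\<close> is the midpoint of bodies \<open>0\<close> and \<open>1\<close>.\<close>
      have "?q n = (a / ?c) *\<^sub>R ((1/2) *\<^sub>R (of_real 1 * cis (0 + 2 * pi * real 0 / real n)) +
           (1/2) *\<^sub>R (of_real 1 * cis (0 + 2 * pi * real 1 / real n)))"
        using cis_add_cis_minus[of "pi / real n" "pi / real n"] c crown_position_outer[of n a 0]
        by (simp add: scaleR_conv_of_real field_simps)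
      also have "\<dots> \<in> convex hull ?P"
        using n a c \<open>\<not> ?c < a\<close> by (intro scaled_midpoint_in_regular_polygon) auto
      finally have "?q n \<in> convex hull (?q ` {..<n})" unfolding P .
      moreover have "?q n \<notin> ?q ` {..<n}" using inj n by auto
      ultimately have "\<not> ?q n extreme_point_of (convex hull ?T)"
        by (intro not_extreme_point_of_convex_hull[of _ "?q ` {..<n}"]) auto
      then show False using conv n by (auto simp: convex_configuration_def)
    qed
    moreover have "a < 1 / ?c"
    proof (rule ccontr)
      assume "\<not> a < 1 / ?c"
      then have ac: "1 \<le> a * ?c" using c by (simp add: field_simps)
      let ?P = "(\<lambda>j. of_real a * cis (pi / real n + 2 * pi * real j / real n)) ` {..<n}"
      have P: "?P = ?q ` (\<lambda>j. n + j) ` {..<n}"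
        by (simp add: image_image crown_position_outer)
      have last: "pi / real n + 2 * pi * real (n - 1) / real n = 2 * pi - pi / real n"
        using n by (simp add: of_nat_diff field_simps)
      \<comment> \<open>\<open>a * ?c\<close> times the direction of body \<open>0\<close> is the midpoint of bodies \<open>n\<close> and \<open>2 * n - 1\<close>.\<close>
      have "?q 0 = (1 / (a * ?c)) *\<^sub>R ((1/2) *\<^sub>R (of_real a * cis (pi / real n + 2 * pi * real 0 / real n)) +
           (1/2) *\<^sub>R (of_real a * cis (pi / real n + 2 * pi * real (n - 1) / real n)))"
        unfolding last using c a n by (simp add: crown_position_inner complex_eq_iff cos_diff sin_diff)
      also have "\<dots> \<in> convex hull ?P"
        using n ac a c by (intro scaled_midpoint_in_regular_polygon) auto
      finally have "?q 0 \<in> convex hull (?q ` (\<lambda>j. n + j) ` {..<n})" unfolding P .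
      moreover have "?q 0 \<notin> ?q ` (\<lambda>j. n + j) ` {..<n}" using inj n by auto
      ultimately have "\<not> ?q 0 extreme_point_of (convex hull ?T)"
        by (intro not_extreme_point_of_convex_hull[of _ "?q ` (\<lambda>j. n + j) ` {..<n}"]) auto
      then show False using conv n by (auto simp: convex_configuration_def)
    qed
    ultimately show "a \<in> convex_radii n" by (simp add: convex_radii_def)
  }
  {
    assume "a \<in> convex_radii n"
    then have lo: "?c < a" and hi: "a * ?c < 1"
      using c by (auto simp: convex_radii_def field_simps)
    show "convex_configuration (2 * n) ?q"
      unfolding convex_configuration_def
    proof (intro allI impI)
      fix i assume i: "i < 2 * n"
      have "\<exists>u. \<forall>j<2 * n. j \<noteq> i \<longrightarrow> inner u (?q j) < inner u (?q i)"
      proof (cases "i < n")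
        case True
        let ?u = "cis (2 * pi * real i / real n)"
        have "inner ?u (?q j) < inner ?u (?q i)" if j: "j < 2 * n" "j \<noteq> i" for j
        proof (cases "j < n")
          case jn: True
          show ?thesis
            using cos_same_ring_less[OF jn True j(2)] True jn cos_same_ring_less[OF True jn] j(2)
            by (simp add: crown_position_inner inner_cis)
        next
          case False
          then have jn: "j - n < n" "n + (j - n) = j" using j by auto
          have "inner ?u (?q j) = a * cos (pi / real n + 2 * pi * real (j - n) / real n - 2 * pi * real i / real n)"
            using crown_position_outer[of n a "j - n"] jn(2)
            by (metis (no_types) inner_of_real_mult(2) inner_cis inner_commute)
          also have "\<dots> \<le> a * ?c"
            using a cos_other_ring_le[OF True jn(1)] by (intro mult_left_mono) auto
          also have "\<dots> < 1" by (rule hi)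
          finally show ?thesis using True by (simp add: crown_position_inner inner_cis)
        qed
        then show ?thesis by blast
      next
        case False
        then have i': "i - n < n" "n + (i - n) = i" using i by auto
        let ?u = "cis (pi / real n + 2 * pi * real (i - n) / real n)"
        have qi: "?q i = of_real a * ?u" using crown_position_outer[of n a "i - n"] i'(2) by simp
        have "inner ?u (?q j) < inner ?u (?q i)" if j: "j < 2 * n" "j \<noteq> i" for j
        proof (cases "j < n")
          case jn: True
          then have "inner ?u (?q j) \<le> ?c"
            using cos_other_ring_le[OF jn i'(1)] by (simp add: crown_position_inner inner_cis)
          also have "\<dots> < a" by (rule lo)
          finally show ?thesis unfolding qi by (simp add: inner_of_real_mult inner_cis)
        next
          case False
          then have jn: "j - n < n" "n + (j - n) = j" "i - n \<noteq> j - n" using j i' by auto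
          have "inner ?u (?q j) = a * cos (2 * pi * real (i - n) / real n - 2 * pi * real (j - n) / real n)"
            using crown_position_outer[of n a "j - n"] jn(2)
            by (simp add: inner_of_real_mult inner_cis)
          also have "\<dots> < a * 1"
            using a cos_same_ring_less[OF jn(1) i'(1)] jn(3) by (intro mult_strict_left_mono) auto
          finally show ?thesis unfolding qi by (simp add: inner_of_real_mult inner_cis)
        qed
        then show ?thesis by blast
      qed
      then obtain u where u: "\<And>j. j < 2 * n \<Longrightarrow> j \<noteq> i \<Longrightarrow> inner u (?q j) < inner u (?q i)" by blast
      then show "?q i extreme_point_of (convex hull ?T)"
        using i by (intro extreme_point_of_convex_hull_supporting[where u = u]) auto
    qed
  }
qed

section \<open>Continuity of \<open>F\<close>, and its sign near \<open>0\<close> and at infinity\<close>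

lemma cos_crown_angle_le:
  assumes "k \<in> {1..n}"
  shows "cos (crown_angle n k) \<le> cos (pi / real n)"
  using assms cos_multiple_le[of n 1 "2 * real k - 1"] by (simp add: crown_angle_def)

lemma crown_denominator_pos:
  assumes "n \<ge> 2" "k \<in> {1..n}" "a \<ge> 0"
  shows "1 + a\<^sup>2 - 2 * a * cos (crown_angle n k) > 0"
proof -
  have "cos (crown_angle n k) < 1"
    using cos_crown_angle_le[OF assms(2)] cos_pi_over_less_1[of n] assms(1) by linarith
  moreover have "1 + a\<^sup>2 - 2 * a * cos (crown_angle n k) = (1 - a)\<^sup>2 + 2 * a * (1 - cos (crown_angle n k))"
    by (simp add: power2_eq_square algebra_simps)
  ultimately show ?thesis
    using assms(3) by (cases "a = 1") (auto intro: add_pos_nonneg)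
qed

lemma continuous_on_crown_F:
  assumes "n \<ge> 2"
  shows "continuous_on {0..} (crown_F n)"
  unfolding crown_F_def[abs_def] crown_C21_def
  using crown_denominator_pos[OF assms]
  by (intro continuous_intros) (auto simp: less_imp_neq[symmetric] dest!: less_imp_neq)

lemma crown_F_sign_change:
  assumes "n \<ge> 2" "0 \<le> s" "s < t" "crown_F n s * crown_F n t < 0"
  obtains z where "s < z" "z < t" "crown_F n z = 0"
proof -
  have cont: "continuous_on {s..t} (crown_F n)"
    using continuous_on_subset[OF continuous_on_crown_F[OF assms(1)]] assms(2) by auto
  have "\<exists>z. s \<le> z \<and> z \<le> t \<and> crown_F n z = 0"
    using IVT'[of "crown_F n" s 0 t] IVT2'[of "crown_F n" t 0 s] cont assms(3,4)
    by (auto simp: mult_less_0_iff less_imp_le)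
  then obtain z where z: "s \<le> z" "z \<le> t" "crown_F n z = 0" by blast
  moreover have "z \<noteq> s" "z \<noteq> t" using z(3) assms(4) by auto
  ultimately show ?thesis using that[of z] by auto
qed

lemma crown_S_pos:
  assumes "n \<ge> 2"
  shows "crown_S n > 0"
proof -
  have "1 / sin (real k * pi / real n) > 0" if "k \<in> {1..n - 1}" for k
    using that assms by (intro divide_pos_pos sin_gt_zero) (auto simp: field_simps)
  then have "(\<Sum>k = 1..n - 1. 1 / sin (real k * pi / real n)) > 0"
    using assms by (intro sum_pos) auto
  then show ?thesis by (simp add: crown_S_def)
qed

text \<open>\<open>crown_C21 n\<close> stays bounded for large radii while the other summand of \<open>crown_F n\<close> grows linearly.
  The bound uses that the denominators are at least \<open>(t - cos \<theta>)\<^sup>2\<close>.\<close>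
lemma crown_F_eventually_pos:
  assumes "n \<ge> 2"
  obtains t where "x < t" "crown_F n t > 0"
proof -
  \<comment> \<open>The sum is at most \<open>2 * n\<close> for radii above \<open>2\<close>, hence the second summand.\<close>
  define t where "t = max 2 x + 2 * real n / crown_S n + 1"
  have S: "crown_S n > 0" by (rule crown_S_pos[OF assms])
  have "2 * real n / crown_S n \<ge> 0" using S by simp
  then have t: "t \<ge> 3" "x < t" by (auto simp: t_def)
  have "(t - cos (crown_angle n k)) / (1 + t\<^sup>2 - 2 * t * cos (crown_angle n k)) powr (3 / 2) \<le> 2"
    if "k \<in> {1..n}" for k
  proof -
    let ?c = "cos (crown_angle n k)"
    let ?Q = "1 + t\<^sup>2 - 2 * t * ?c"
    have "?Q = (t - ?c)\<^sup>2 + (1 - ?c\<^sup>2)"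
      by (simp add: power2_eq_square algebra_simps)
    then have Q: "?Q \<ge> (t - ?c)\<^sup>2" using abs_square_le_1[of ?c] by simp
    have d: "t - ?c \<ge> 1" using t cos_le_one[of "crown_angle n k"] by linarith
    then have "1 \<le> (t - ?c)\<^sup>2" by (simp add: one_le_power)
    with Q have "?Q powr 1 \<le> ?Q powr (3 / 2)" by (intro powr_mono) auto
    then have "?Q \<le> ?Q powr (3 / 2)" using Q d by simp
    moreover have "t - ?c \<le> (t - ?c)\<^sup>2" using d by (simp add: power2_eq_square)
    ultimately have "t - ?c \<le> ?Q powr (3 / 2)" using Q by linarith
    then show ?thesis using d by (simp add: divide_le_eq)
  qed
  then have "crown_C21 n t \<le> (\<Sum>k=1..n. 2)"
    unfolding crown_C21_def by (intro sum_mono) auto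
  also have "\<dots> = crown_S n * (2 * real n / crown_S n)" using S by simp
  also have "\<dots> < crown_S n * t"
    using S by (intro mult_strict_left_mono) (simp_all add: t_def)
  finally show ?thesis using that[of t] t by (simp add: crown_F_def)
qed

text \<open>For \<open>n = 2\<close> the second sum would be \<open>- 2\<close>: the doubled angles are equally spaced
  around the circle only from \<open>n = 3\<close> on.\<close>
lemma sum_cos_crown_angle:
  assumes "n \<ge> 3"
  shows "(\<Sum>k=1..n. cos (crown_angle n k)) = 0" "(\<Sum>k=1..n. cos (2 * crown_angle n k)) = 0"
proof -
  have *: "(\<Sum>k=1..n. cos (real m * crown_angle n k)) = 0"
    if "cos (real m * 2 * pi / real n) < 1" for m
  proof -
    have ne: "cis (real m * 2 * pi / real n) \<noteq> 1" using that by (auto simp: complex_eq_iff)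
    have "(\<Sum>k=1..n. cis (real m * crown_angle n k)) =
        (\<Sum>j<n. cis (real m * pi / real n + real j * (real m * 2 * pi / real n)))"
      by (rule sum.reindex_bij_witness[of _ Suc "\<lambda>k. k - 1"])
         (auto simp: crown_angle_def of_nat_diff field_simps)
    also have "\<dots> = 0"
    proof (rule sum_cis_arithmetic[OF ne])
      have "real n * (real m * 2 * pi / real n) = 2 * pi * real m" using assms by simp
      then show "cis (real n * (real m * 2 * pi / real n)) = 1"
        by (simp add: cis_multiple_2pi)
    qed
    finally have "Re (\<Sum>k=1..n. cis (real m * crown_angle n k)) = 0" by simp
    then show ?thesis by simp
  qed
  have 1: "cos (2 * pi / real n) < 1" using assms by (intro cos_2pi_over_less_1) simp
  have "cos (4 * pi / real n) \<le> cos (2 * pi / real n)"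
    using assms by (intro cos_multiple_le) auto
  then have 2: "cos (4 * pi / real n) < 1" using 1 by linarith
  show "(\<Sum>k=1..n. cos (crown_angle n k)) = 0" using *[of 1] 1 by simp
  show "(\<Sum>k=1..n. cos (2 * crown_angle n k)) = 0" using *[of 2] 2 by simp
qed

text \<open>\<open>crown_F n\<close> vanishes at \<open>0\<close> with derivative \<open>crown_S n + n / 2 > 0\<close>. Each summand of \<open>crown_C21 n\<close>
  has derivative \<open>1 - 3 * c\<^sup>2\<close> there, and \<open>c\<^sup>2\<close> has mean \<open>1 / 2\<close> over the angles.\<close>
lemma crown_F_pos_near_0:
  assumes "n \<ge> 3"
  obtains d where "d > 0" "\<And>a. 0 < a \<Longrightarrow> a < d \<Longrightarrow> crown_F n a > 0"
proof -
  have deriv: "((\<lambda>a. (a - c) / (1 + a\<^sup>2 - 2 * a * c) powr (3 / 2)) has_real_derivative 1 - 3 * c\<^sup>2) (at 0)"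
    for c :: real
    by (rule derivative_eq_intros refl | simp add: power2_eq_square)+
  have F0: "crown_F n 0 = 0"
    using sum_cos_crown_angle(1)[OF assms] by (simp add: crown_F_def crown_C21_def sum_negf)
  have "(\<Sum>k=1..n. 1 - 3 * (cos (crown_angle n k))\<^sup>2) = (\<Sum>k=1..n. - 1 / 2 - 3 / 2 * cos (2 * crown_angle n k))"
    by (rule sum.cong[OF refl]) (simp only: cos_double_cos, simp add: field_simps)
  also have "\<dots> = - real n / 2"
    using sum_cos_crown_angle(2)[OF assms] by (simp add: sum_subtractf sum_negf flip: sum_distrib_left sum_divide_distrib)
  finally have "(\<Sum>k=1..n. 1 - 3 * (cos (crown_angle n k))\<^sup>2) = - real n / 2" .
  moreover have "(crown_C21 n has_real_derivative (\<Sum>k=1..n. 1 - 3 * (cos (crown_angle n k))\<^sup>2)) (at 0)"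
    unfolding crown_C21_def[abs_def] by (intro DERIV_sum deriv)
  ultimately have "(crown_F n has_real_derivative crown_S n - (- real n / 2)) (at 0)"
    unfolding crown_F_def[abs_def] by (auto intro!: derivative_eq_intros)
  moreover have "crown_S n - (- real n / 2) > 0" using crown_S_pos[of n] assms by (simp add: add_pos_nonneg)
  ultimately obtain d where "d > 0" "\<And>h. 0 < h \<Longrightarrow> h < d \<Longrightarrow> crown_F n 0 < crown_F n (0 + h)"
    using DERIV_pos_inc_right by blast
  then show ?thesis using that[of d] F0 by auto
qed

section \<open>Negativity of \<open>F\<close> at \<open>1\<close> and at the outer end of the convex range\<close>

lemma sin_half_crown_angle_pos:
  assumes "k \<in> {1..n}"
  shows "sin (crown_angle n k / 2) > 0"
proof (rule sin_gt_zero)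
  have k: "1 \<le> real k" "real k \<le> real n" using assms by auto
  then have "0 < (2 * real k - 1) * pi" by (intro mult_pos_pos) auto
  then show "0 < crown_angle n k / 2" using k by (simp add: crown_angle_def)
  have "(2 * real k - 1) * pi < (2 * real n) * pi" using k by (intro mult_strict_right_mono) auto
  then show "crown_angle n k / 2 < pi" using k by (simp add: crown_angle_def field_simps)
qed

lemma crown_angle_mean:
  assumes "n > 0"
  shows "crown_angle n k / 2 = real k * pi / real n - pi / (2 * real n)"
    "crown_angle n (Suc k) / 2 = real k * pi / real n + pi / (2 * real n)"
  using assms by (simp_all add: crown_angle_def field_simps)

text \<open>Midpoint convexity of the cosecant, from the inequality of harmonic and arithmetic mean.\<close>
lemma inverse_sin_midpoint:
  fixes x h :: real
  assumes "sin (x - h) > 0" "sin (x + h) > 0" "sin x > 0"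
  shows "1 / sin x \<le> (1 / sin (x - h) + 1 / sin (x + h)) / 2"
proof -
  define p q where "p = sin (x - h)" and "q = sin (x + h)"
  have pq: "p > 0" "q > 0" using assms by (simp_all add: p_def q_def)
  have "p + q = 2 * sin x * cos h" by (simp add: p_def q_def sin_add sin_diff)
  also have "\<dots> \<le> 2 * sin x" using assms(3) by simp
  finally have le: "p + q \<le> 2 * sin x" .
  have "1 / sin x = 2 / (2 * sin x)" by simp
  also have "\<dots> \<le> 2 / (p + q)" using le pq by (intro divide_left_mono) auto
  also have "\<dots> \<le> (1 / p + 1 / q) / 2"
  proof -
    have "4 * (p * q) \<le> (p + q) * (p + q)"
      using zero_le_power2[of "p - q"] by (simp add: power2_eq_square algebra_simps)
    then show ?thesis using pq by (simp add: field_simps)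
  qed
  finally show ?thesis by (simp add: p_def q_def)
qed

text \<open>The multiples of \<open>pi / n\<close>, over which \<open>crown_S n\<close> sums, are the midpoints of the half crown angles,
  over which the attraction of the other ring sums. Convexity therefore compares the two sums.\<close>
lemma inverse_sin_between_crown_angles:
  assumes "k \<in> {1..n - 1}"
  shows "1 / sin (real k * pi / real n) \<le>
    (1 / sin (crown_angle n k / 2) + 1 / sin (crown_angle n (Suc k) / 2)) / 2"
proof -
  have n: "n > 0" using assms by auto
  have "sin (real k * pi / real n) > 0"
    using assms by (intro sin_gt_zero) (auto simp: field_simps)
  moreover have "sin (crown_angle n k / 2) > 0" "sin (crown_angle n (Suc k) / 2) > 0"
    using assms by (auto intro!: sin_half_crown_angle_pos)
  ultimately show ?thesis
    unfolding crown_angle_mean(1)[OF n, of k] crown_angle_mean(2)[OF n, of k] by (intro inverse_sin_midpoint)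
qed

text \<open>At \<open>a = 1\<close> both sums run over cosecants with the same factor, and averaging neighbours loses half of
  the two outermost terms.\<close>
lemma crown_F_1_neg:
  assumes "n \<ge> 2"
  shows "crown_F n 1 < 0"
proof -
  define r where "r k = 1 / sin (crown_angle n k / 2)" for k
  have pos: "r k > 0" if "k \<in> {1..n}" for k
    using sin_half_crown_angle_pos[OF that] by (simp add: r_def)
  obtain m where m: "n = Suc m" using assms by (cases n) auto
  have "(\<Sum>k=1..n - 1. 1 / sin (real k * pi / real n)) \<le> (\<Sum>k=1..n - 1. (r k + r (Suc k)) / 2)"
    unfolding r_def by (intro sum_mono inverse_sin_between_crown_angles)
  also have "\<dots> = ((\<Sum>k=1..n - 1. r k) + (\<Sum>k=1..n - 1. r (Suc k))) / 2"
    by (simp add: sum.distrib sum_divide_distrib[symmetric])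
  also have "(\<Sum>k=1..n - 1. r k) = (\<Sum>k=1..n. r k) - r n"
    by (simp add: m)
  also have "(\<Sum>k=1..n - 1. r (Suc k)) = (\<Sum>k=1..n. r k) - r 1"
  proof -
    have "(\<Sum>k=1..n. r k) = r 1 + (\<Sum>k=Suc 1..n. r k)"
      using assms by (intro sum.atLeast_Suc_atMost) auto
    also have "(\<Sum>k=Suc 1..n. r k) = (\<Sum>k=1..m. r (Suc k))"
      unfolding m by (rule sum.shift_bounds_cl_Suc_ivl)
    finally show ?thesis by (simp add: m)
  qed
  also have "((\<Sum>k=1..n. r k) - r n + ((\<Sum>k=1..n. r k) - r 1)) / 2 < (\<Sum>k=1..n. r k)"
    using pos[of 1] pos[of n] assms by simp
  also have "\<dots> = 4 * crown_C21 n 1"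
    unfolding crown_C21_def sum_distrib_left
  proof (rule sum.cong)
    fix k assume "k \<in> {1..n}"
    define s where "s = sin (crown_angle n k / 2)"
    have s: "s > 0" unfolding s_def by (rule sin_half_crown_angle_pos) fact
    have c: "cos (crown_angle n k) = 1 - 2 * s\<^sup>2"
      using cos_double_sin[of "crown_angle n k / 2"] by (simp add: s_def)
    have "1 + 1\<^sup>2 - 2 * 1 * cos (crown_angle n k) = (2 * s)\<^sup>2"
      by (simp add: c power2_eq_square)
    then have "(1 + 1\<^sup>2 - 2 * 1 * cos (crown_angle n k)) powr (3 / 2) = (2 * s) ^ 3"
      using s by (simp only: powr_three_halves[OF zero_le_power2] real_sqrt_abs)
    then show "r k = 4 * ((1 - cos (crown_angle n k)) /
        (1 + 1\<^sup>2 - 2 * 1 * cos (crown_angle n k)) powr (3 / 2))"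
      using s by (simp only: r_def s_def[symmetric] c) (simp add: power2_eq_square power3_eq_cube)
  qed simp
  finally show ?thesis by (simp add: crown_F_def crown_S_def)
qed

text \<open>Inversion in the unit circle takes the body at radius \<open>a = 1 / b\<close> to the point \<open>b\<close>, and \<open>D\<close> is the
  distance of this point from the point of the unit circle at an angle with cosine \<open>c\<close>.\<close>
lemma crown_term_inverse_radius:
  fixes b c D :: real
  assumes "b > 0" "D = sqrt (1 + b\<^sup>2 - 2 * b * c)" "1 + b\<^sup>2 - 2 * b * c \<ge> 0"
  shows "(1 / b - c) / (1 + (1 / b)\<^sup>2 - 2 * (1 / b) * c) powr (3 / 2) = b\<^sup>2 * ((1 - b * c) / D ^ 3)"
proof -
  have D: "D \<ge> 0" "D\<^sup>2 = 1 + b\<^sup>2 - 2 * b * c" using assms by auto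
  have "1 + (1 / b)\<^sup>2 - 2 * (1 / b) * c = (1 + b\<^sup>2 - 2 * b * c) / b\<^sup>2"
    using assms(1) by (simp add: field_simps power2_eq_square)
  also have "\<dots> = (D / b)\<^sup>2" by (simp add: D(2) power_divide)
  finally have "(1 + (1 / b)\<^sup>2 - 2 * (1 / b) * c) powr (3 / 2) = (D / b) ^ 3"
    using D(1) assms(1) by (simp only: powr_three_halves[OF zero_le_power2] real_sqrt_abs) simp
  then have "(1 / b - c) / (1 + (1 / b)\<^sup>2 - 2 * (1 / b) * c) powr (3 / 2) = (1 / b - c) / (D / b) ^ 3"
    by (simp only:)
  also have "\<dots> = b\<^sup>2 * ((1 - b * c) / D ^ 3)"
    using assms(1) by (cases "D = 0") (simp_all add: power_divide field_simps power2_eq_square power3_eq_cube)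
  finally show ?thesis .
qed

text \<open>\<open>D\<close> is at most the chord \<open>2 * s\<close> from the point \<open>1\<close>, and \<open>1 - b * c = (D\<^sup>2 + 1 - b\<^sup>2) / 2\<close> is
  at least \<open>D\<^sup>2 / 2\<close>. So the terms are, up to the factor \<open>b\<^sup>2\<close>, at least those at \<open>a = 1\<close>.\<close>
lemma crown_term_at_outer_bound:
  assumes n: "n \<ge> 3" and k: "k \<in> {1..n}"
  defines "b \<equiv> cos (pi / real n)" and "c \<equiv> cos (crown_angle n k)"
  shows "(1 / b - c) / (1 + (1 / b)\<^sup>2 - 2 * (1 / b) * c) powr (3 / 2) \<ge> b\<^sup>2 / (4 * sin (crown_angle n k / 2))"
proof -
  define s D where "s = sin (crown_angle n k / 2)" and "D = sqrt (1 + b\<^sup>2 - 2 * b * c)"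
  have b: "0 < b" "b < 1" using cos_pi_over_pos[OF n] cos_pi_over_less_1[of n] n by (auto simp: b_def)
  have s: "s > 0" unfolding s_def by (rule sin_half_crown_angle_pos[OF k])
  have c: "c = 1 - 2 * s\<^sup>2"
    using cos_double_sin[of "crown_angle n k / 2"] by (simp add: s_def c_def)
  have cb: "c \<le> b" unfolding b_def c_def by (rule cos_crown_angle_le[OF k])
  have D2: "1 + b\<^sup>2 - 2 * b * c > 0"
    unfolding c_def using crown_denominator_pos[OF _ k] b n by simp
  then have D: "D > 0" "D\<^sup>2 = 1 + b\<^sup>2 - 2 * b * c" by (auto simp: D_def)
  have "(2 * s)\<^sup>2 - D\<^sup>2 = (1 - b) * (4 * s\<^sup>2 - (1 - b))"
    unfolding D(2) c by (simp add: power2_eq_square algebra_simps)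
  also have "\<dots> \<ge> 0"
  proof (rule mult_nonneg_nonneg)
    show "0 \<le> 4 * s\<^sup>2 - (1 - b)" using cb c zero_le_power2[of s] by linarith
  qed (use b in simp)
  finally have "D\<^sup>2 \<le> (2 * s)\<^sup>2" by simp
  then have "D \<le> 2 * s" by (rule power2_le_imp_le) (use s in simp)
  then have "1 / (4 * s) \<le> 1 / (2 * D)" using D(1) s by (intro divide_left_mono) auto
  also have "\<dots> = (D\<^sup>2 / 2) / D ^ 3" using D(1) by (simp add: power2_eq_square power3_eq_cube)
  also have "\<dots> \<le> (1 - b * c) / D ^ 3"
  proof (rule divide_right_mono)
    have "b\<^sup>2 \<le> 1" using b by (simp add: power_le_one)
    then show "D\<^sup>2 / 2 \<le> 1 - b * c" unfolding D(2) by simp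
  qed (use D(1) in simp)
  finally have "b\<^sup>2 * (1 / (4 * s)) \<le> b\<^sup>2 * ((1 - b * c) / D ^ 3)"
    by (intro mult_left_mono) auto
  then show ?thesis
    using crown_term_inverse_radius[OF b(1) D_def] D2 by (simp add: s_def)
qed

text \<open>For the two nearest bodies of the other ring, at which \<open>c = b\<close>, the preceding estimate is too weak:
  it loses more than half of these terms, which are needed in full to compensate for the factor \<open>b ^ 3\<close>
  lost elsewhere.\<close>
lemma crown_term_at_outer_bound_neighbour:
  assumes n: "n \<ge> 3" and c: "c = cos (pi / real n)"
  defines "b \<equiv> cos (pi / real n)"
  shows "(1 / b - c) / (1 + (1 / b)\<^sup>2 - 2 * (1 / b) * c) powr (3 / 2) = b\<^sup>2 / sin (pi / real n)"
proof -
  have c: "c = b" by (simp add: b_def c)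
  have b: "b > 0" unfolding b_def by (rule cos_pi_over_pos[OF n])
  have s: "sin (pi / real n) > 0" using n by (intro sin_gt_zero) (auto simp: field_simps)
  have s2: "(sin (pi / real n))\<^sup>2 = 1 - b\<^sup>2" by (simp add: b_def sin_squared_eq)
  have e: "1 + b\<^sup>2 - 2 * b * c = (sin (pi / real n))\<^sup>2"
    unfolding s2 c by (simp add: power2_eq_square)
  have "(1 / b - c) / (1 + (1 / b)\<^sup>2 - 2 * (1 / b) * c) powr (3 / 2)
      = b\<^sup>2 * ((1 - b * c) / sin (pi / real n) ^ 3)"
    by (rule crown_term_inverse_radius[OF b]) (use s in \<open>simp_all only: e, simp_all\<close>)
  also have "1 - b * c = (sin (pi / real n))\<^sup>2" unfolding s2 c by (simp add: power2_eq_square)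
  finally show ?thesis using s by (simp add: power2_eq_square power3_eq_cube)
qed

text \<open>\<open>cos (pi / 5)\<close> is the positive root of \<open>4 * b\<^sup>2 - 2 * b - 1\<close>, which follows from
  \<open>cos (3 * pi / 5) = - cos (2 * pi / 5)\<close>.\<close>
lemma cos_pi_over_5: "cos (pi / 5) \<ge> 4 / 5"
proof -
  define b where "b = cos (pi / 5)"
  have "cos (pi / 5) > cos (pi / 3)" by (intro cos_monotone_0_pi) auto
  then have b: "b > 1 / 2" by (simp add: b_def cos_60)
  have "cos (3 * (pi / 5)) = - cos (2 * (pi / 5))"
    using cos_pi_minus[of "2 * (pi / 5)"] by simp
  then have "4 * b ^ 3 - 3 * b = - (2 * b\<^sup>2 - 1)"
    unfolding cos_treble_cos cos_double_cos b_def .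
  then have "(b + 1) * (4 * b\<^sup>2 - 2 * b - 1) = 0"
    by (simp add: power2_eq_square power3_eq_cube algebra_simps)
  then have "b + 1 = 0 \<or> 4 * b\<^sup>2 - 2 * b - 1 = 0" by (simp only: mult_eq_0_iff)
  then have "4 * b\<^sup>2 - 2 * b - 1 = 0" using b by linarith
  then have "2 * b * (2 * b - 1) = 1" by (simp add: power2_eq_square algebra_simps)
  moreover have "2 * b * (2 * b - 1) < 8 / 5 * (3 / 5)" if "b < 4 / 5"
    using b that by (intro mult_strict_mono) auto
  ultimately show ?thesis unfolding b_def[symmetric] by (cases "b < 4 / 5") auto
qed

text \<open>The numerical inequality to which \<open>crown_F n (1 / cos (pi / n)) < 0\<close> reduces. For \<open>n \<ge> 7\<close> the
  coarse bound \<open>pi < 4\<close> suffices; the smaller cases use the values of \<open>cos (pi / 4)\<close> and \<open>cos (pi / 5)\<close>.\<close>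
lemma cos_pi_over_cubed_gt:
  assumes "n \<ge> 4"
  shows "(cos (pi / real n)) ^ 3 * (real n + 5) > real n - 1"
proof -
  consider "n = 4" | "n = 5 \<or> n = 6" | "n \<ge> 7" using assms by linarith
  then show ?thesis
  proof cases
    case 1
    have "(4 / 3 :: real) < sqrt 2" by (rule real_less_rsqrt) (simp add: power2_eq_square)
    then show ?thesis using 1 by (simp add: cos_45 power_divide power3_eq_cube)
  next
    case 2
    then have "cos (pi / 5) \<le> cos (pi / real n)" by (intro cos_monotone_0_pi_le) (auto simp: field_simps)
    then have "(4 / 5) ^ 3 \<le> cos (pi / real n) ^ 3" using cos_pi_over_5 by (intro power_mono) auto
    then have "(4 / 5) ^ 3 * (real n + 5) \<le> cos (pi / real n) ^ 3 * (real n + 5)"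
      by (intro mult_right_mono) auto
    then show ?thesis using 2 by (auto simp: power3_eq_cube)
  next
    case 3
    \<comment> \<open>\<open>1 - cos (pi / n) = 2 * (sin (pi / (2 * n)))\<^sup>2 \<le> pi\<^sup>2 / (2 * n\<^sup>2) < 8 / n\<^sup>2\<close>\<close>
    define u where "u = 8 / (real n)\<^sup>2"
    have u: "0 \<le> u" "u \<le> 1"
      using 3 mult_mono[of 7 "real n" 7 "real n"] by (auto simp: u_def power2_eq_square field_simps)
    have "sin (pi / real n / 2) \<le> pi / real n / 2" by (intro sin_x_le_x) simp
    also have "\<dots> \<le> 2 / real n" using pi_less_4 3 by (simp add: field_simps)
    finally have "(sin (pi / real n / 2))\<^sup>2 \<le> (2 / real n)\<^sup>2"
      using 3 by (intro power_mono sin_ge_zero) (auto simp: field_simps)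
    then have "cos (pi / real n) \<ge> 1 - u"
      using cos_double_sin[of "pi / real n / 2"] by (simp add: u_def power_divide)
    then have "cos (pi / real n) ^ 3 \<ge> (1 - u) ^ 3" using u by (intro power_mono) auto
    moreover have "(1 - u) ^ 3 = 1 - 3 * u + u\<^sup>2 * (3 - u)"
      by (simp add: power2_eq_square power3_eq_cube algebra_simps)
    moreover have "u\<^sup>2 * (3 - u) \<ge> 0" using u by simp
    ultimately have "(1 - 3 * u) * (real n + 5) \<le> cos (pi / real n) ^ 3 * (real n + 5)"
      by (intro mult_right_mono) auto
    moreover have "3 * u * (real n + 5) < 6"
    proof -
      have "7 * real n \<le> real n * real n" using 3 by (intro mult_right_mono) auto
      then have "6 * (7 * real n) \<le> 6 * (real n * real n)" by (intro mult_left_mono) auto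
      moreover have "24 * (real n + 5) < 6 * (7 * real n)" using 3 by simp
      ultimately have "24 * (real n + 5) < 6 * (real n * real n)" by (rule order_less_le_trans[rotated])
      then show ?thesis using 3 by (simp add: u_def power2_eq_square field_simps)
    qed
    ultimately show ?thesis by (simp add: algebra_simps)
  qed
qed

text \<open>Write \<open>b = cos (pi / n)\<close>, \<open>\<sigma> = sin (pi / n)\<close>, and let \<open>Q\<close> be the sum that bounds the inner terms of
  \<open>4 * crown_S n\<close> by convexity. The two outer terms of that sum are \<open>1 / \<sigma>\<close>, so
  \<open>4 * crown_S n \<le> 2 / \<sigma> + Q\<close>. The two nearest terms of \<open>crown_C21 n (1 / b)\<close> are \<open>b\<^sup>2 / \<sigma>\<close>, and the
  others add up to at least \<open>b\<^sup>2 * Q / 4\<close>. Since \<open>Q \<le> (n - 3) / \<sigma>\<close>, negativity follows from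
  \<open>b ^ 3 * (n + 5) > n - 1\<close>.\<close>
lemma crown_F_outer_bound_neg:
  assumes n: "n \<ge> 4"
  shows "crown_F n (1 / cos (pi / real n)) < 0"
proof -
  define b \<sigma> where "b = cos (pi / real n)" and "\<sigma> = sin (pi / real n)"
  define r where "r k = 1 / sin (crown_angle n k / 2)" for k
  define t where "t k = (1 / b - cos (crown_angle n k)) /
        (1 + (1 / b)\<^sup>2 - 2 * (1 / b) * cos (crown_angle n k)) powr (3 / 2)" for k
  define h where "h k = 1 / sin (real k * pi / real n)" for k
  define Q where "Q = ((\<Sum>k=2..n - 2. r k) + (\<Sum>k=2..n - 2. r (Suc k))) / 2"
  have b: "0 < b" "b < 1" using cos_pi_over_pos[of n] cos_pi_over_less_1[of n] n by (auto simp: b_def)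
  have \<sigma>: "\<sigma> > 0" unfolding \<sigma>_def using n by (intro sin_gt_zero) (auto simp: field_simps)
  have r_pos: "r k > 0" if "k \<in> {1..n}" for k
    using sin_half_crown_angle_pos[OF that] by (simp add: r_def)
  have r_le: "r k \<le> 1 / \<sigma>" if k: "k \<in> {2..n - 1}" for k
  proof -
    have k': "2 \<le> real k" "real k \<le> real n - 1" using k n by auto
    define x where "x = crown_angle n k / 2"
    have "2 * pi / (2 * real n) \<le> (2 * real k - 1) * pi / (2 * real n)"
      using k' by (intro divide_right_mono mult_right_mono) auto
    moreover have "(2 * real k - 1) * pi / (2 * real n) \<le> (2 * real n - 2) * pi / (2 * real n)"
      using k' by (intro divide_right_mono mult_right_mono) auto
    moreover have "(2 * real n - 2) * pi / (2 * real n) = pi - pi / real n"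
      "2 * pi / (2 * real n) = pi / real n" "(2 * real k - 1) * pi / (2 * real n) = x"
      using n by (simp_all add: x_def crown_angle_def field_simps)
    ultimately have x: "pi / real n \<le> x" "x \<le> pi - pi / real n"
      by (simp_all only:)
    have "0 < pi / real n" using n by simp
    have "sin (pi / real n) = cos (pi / 2 - pi / real n)" by (simp add: cos_diff)
    also have "\<dots> \<le> cos \<bar>pi / 2 - x\<bar>"
      using x \<open>0 < pi / real n\<close> by (intro cos_monotone_0_pi_le) linarith+
    also have "\<dots> = sin x" unfolding cos_abs_real by (simp add: cos_diff)
    finally have "\<sigma> \<le> sin x" by (simp add: \<sigma>_def)
    then show ?thesis using \<sigma> by (simp add: r_def x_def frac_le)
  qed
  have ends: "(\<Sum>k=1..N. f k) = f 1 + (\<Sum>k=2..N - 1. f k) + f N" if "N \<ge> 2" for f :: "nat \<Rightarrow> real" and N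
  proof -
    have "(\<Sum>k=1..N. f k) = f 1 + (\<Sum>k=Suc 1..N. f k)"
      using that by (intro sum.atLeast_Suc_atMost) auto
    also have "(\<Sum>k=Suc 1..N. f k) = (\<Sum>k=2..N - 1. f k) + f N"
      using that by (cases N) (auto simp: numeral_2_eq_2)
    finally show ?thesis by simp
  qed
  have "h 1 = 1 / \<sigma>" by (simp add: h_def \<sigma>_def)
  moreover have "h (n - 1) = 1 / \<sigma>"
  proof -
    have "real (n - 1) * pi / real n = pi - pi / real n" using n by (simp add: of_nat_diff field_simps)
    then show ?thesis by (simp add: h_def \<sigma>_def)
  qed
  moreover have "(\<Sum>k=2..n - 2. h k) \<le> Q"
  proof -
    have "(\<Sum>k=2..n - 2. h k) \<le> (\<Sum>k=2..n - 2. (r k + r (Suc k)) / 2)"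
      unfolding h_def r_def by (intro sum_mono inverse_sin_between_crown_angles) auto
    then show ?thesis by (simp add: Q_def sum.distrib sum_divide_distrib[symmetric])
  qed
  ultimately have S: "4 * crown_S n \<le> 2 / \<sigma> + Q"
    using ends[of "n - 1" h, unfolded diff_diff_left one_add_one] n by (simp add: crown_S_def h_def)
  have mean_le: "(x + y) / 2 \<le> z" if "x \<le> z" "y \<le> z" for x y z :: real
    using that by simp
  have Q_le: "Q \<le> (real n - 3) / \<sigma>"
  proof -
    have "(\<Sum>k=2..n - 2. r k) \<le> (\<Sum>k=2..n - 2. 1 / \<sigma>)"
      using n by (intro sum_mono r_le) auto
    moreover have "(\<Sum>k=2..n - 2. r (Suc k)) \<le> (\<Sum>k=2..n - 2. 1 / \<sigma>)"
      using n by (intro sum_mono r_le) auto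
    moreover have "(\<Sum>k=2..n - 2. 1 / \<sigma>) = (real n - 3) / \<sigma>"
      using n by (simp add: of_nat_diff)
    ultimately have "(\<Sum>k=2..n - 2. r k) \<le> (real n - 3) / \<sigma>"
      "(\<Sum>k=2..n - 2. r (Suc k)) \<le> (real n - 3) / \<sigma>" by (simp_all only:)
    then show ?thesis unfolding Q_def by (rule mean_le)
  qed
  have Q_le_sum: "Q \<le> (\<Sum>k=2..n - 1. r k)"
  proof -
    have "(\<Sum>k=2..n - 2. r k) \<le> (\<Sum>k=2..n - 1. r k)"
      using n r_pos by (intro sum_mono2) (auto intro: less_imp_le)
    moreover have "(\<Sum>k=2..n - 2. r (Suc k)) = (\<Sum>k\<in>Suc ` {2..n - 2}. r k)"
      unfolding sum.reindex[OF inj_Suc] comp_def ..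
    moreover have "\<dots> \<le> (\<Sum>k=2..n - 1. r k)"
      using n r_pos by (intro sum_mono2) (auto intro: less_imp_le)
    ultimately show ?thesis unfolding Q_def by (intro mean_le) (simp_all only:)
  qed
  have "t 1 = b\<^sup>2 / \<sigma>"
    unfolding t_def b_def \<sigma>_def using n
    by (intro crown_term_at_outer_bound_neighbour) (auto simp: crown_angle_def)
  moreover have "t n = b\<^sup>2 / \<sigma>"
  proof -
    have "crown_angle n n = 2 * pi - pi / real n" using n by (simp add: crown_angle_def field_simps)
    then have "cos (crown_angle n n) = cos (pi / real n)" by (simp add: cos_diff)
    then show ?thesis
      unfolding t_def b_def \<sigma>_def using n by (intro crown_term_at_outer_bound_neighbour) auto
  qed
  moreover have "(\<Sum>k=2..n - 1. t k) \<ge> b\<^sup>2 * (Q / 4)"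
  proof -
    have "b\<^sup>2 * (Q / 4) \<le> b\<^sup>2 * ((\<Sum>k=2..n - 1. r k) / 4)"
      using Q_le_sum by (intro mult_left_mono) auto
    also have "\<dots> = (\<Sum>k=2..n - 1. b\<^sup>2 / (4 * sin (crown_angle n k / 2)))"
      by (simp add: r_def sum_distrib_left sum_divide_distrib mult.commute)
    also have "\<dots> \<le> (\<Sum>k=2..n - 1. t k)"
      unfolding t_def b_def using n by (intro sum_mono crown_term_at_outer_bound) auto
    finally show ?thesis .
  qed
  ultimately have C: "crown_C21 n (1 / b) \<ge> b\<^sup>2 * (Q / 4 + 2 / \<sigma>)"
    using ends[of n t] n unfolding crown_C21_def t_def[symmetric] by (simp add: algebra_simps)
  have "b * crown_F n (1 / b) = crown_S n - b * crown_C21 n (1 / b)"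
    using b by (simp add: crown_F_def field_simps)
  also have "\<dots> \<le> (2 / \<sigma> + Q) / 4 - b * (b\<^sup>2 * (Q / 4 + 2 / \<sigma>))"
    by (rule diff_mono[OF _ mult_left_mono[OF C less_imp_le[OF b(1)]]]) (use S in simp)
  also have "\<dots> = (Q * (1 - b ^ 3) - (8 * b ^ 3 - 2) / \<sigma>) / 4"
    by (simp add: power2_eq_square power3_eq_cube algebra_simps diff_divide_distrib add_divide_distrib)
  also have "\<dots> \<le> ((real n - 3) / \<sigma> * (1 - b ^ 3) - (8 * b ^ 3 - 2) / \<sigma>) / 4"
    using Q_le b by (intro divide_right_mono diff_right_mono mult_right_mono) (auto simp: power_le_one)
  also have "\<dots> = (real n - 1 - b ^ 3 * (real n + 5)) / (4 * \<sigma>)"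
    using \<sigma> by (simp add: field_simps)
  also have "\<dots> < 0"
    using cos_pi_over_cubed_gt[OF n] \<sigma> by (intro divide_neg_pos) (auto simp: b_def)
  finally have "b * crown_F n (1 / b) < 0" .
  then show ?thesis using b by (simp add: b_def mult_less_0_iff)
qed

section \<open>Four or more bodies in each ring\<close>

text \<open>\<open>F\<close> is positive near \<open>0\<close>, negative at \<open>1\<close> and at \<open>1 / cos (pi / n)\<close>, and positive far out. This already
  forces one zero in \<open>(0, 1)\<close> and one beyond \<open>1 / cos (pi / n)\<close>; as there are only two zeros, the sign of
  \<open>F\<close> is determined on either side of the smaller one.\<close>
lemma crown_zeros_two:
  assumes n: "n \<ge> 4" and card: "card (crown_zeros n) = 2"
  shows "0 < crown_z1 n" "crown_z1 n < 1" "1 / cos (pi / real n) < crown_z2 n"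
    and "\<And>a. 0 < a \<Longrightarrow> a \<le> crown_z1 n \<Longrightarrow> crown_F n a \<ge> 0"
    and "\<And>a. crown_z1 n < a \<Longrightarrow> a < crown_z2 n \<Longrightarrow> crown_F n a < 0"
proof -
  let ?R = "1 / cos (pi / real n)"
  have c: "0 < cos (pi / real n)" "cos (pi / real n) < 1"
    using cos_pi_over_pos[of n] cos_pi_over_less_1[of n] n by auto
  have R: "1 < ?R" "crown_F n ?R < 0" using c crown_F_outer_bound_neg[OF n] by auto
  have F1: "crown_F n 1 < 0" using n by (intro crown_F_1_neg) auto
  obtain d where d: "d > 0" "\<And>a. 0 < a \<Longrightarrow> a < d \<Longrightarrow> crown_F n a > 0"
    using crown_F_pos_near_0[of n] n by auto
  have small: "\<exists>e. 0 < e \<and> e < a \<and> crown_F n e > 0" if "a > 0" for a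
    using d that by (intro exI[of _ "min a d / 2"]) auto
  obtain e where e: "0 < e" "e < 1" "crown_F n e > 0" using small[of 1] by auto
  obtain x where x: "e < x" "x < 1" "crown_F n x = 0"
    using crown_F_sign_change[of n e 1] e F1 n by (auto simp: mult_pos_neg)
  obtain t where t: "?R < t" "crown_F n t > 0"
    using crown_F_eventually_pos[of n ?R] n by auto
  obtain y where y: "?R < y" "y < t" "crown_F n y = 0"
    using crown_F_sign_change[of n ?R t] t R c n by (auto simp: mult_neg_pos)
  have xy: "x < y" using x y R by linarith
  have fin: "finite (crown_zeros n)" using card by (intro card_ge_0_finite) simp
  have sub: "{x, y} \<subseteq> crown_zeros n" using x y e R by (auto simp: crown_zeros_def)
  have "{x, y} = crown_zeros n"
    using xy card by (intro card_subset_eq[OF fin sub]) simp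
  then have Z: "crown_zeros n = {x, y}" by simp
  then have z: "crown_z1 n = x" "crown_z2 n = y"
    using xy by (simp_all add: crown_z1_def crown_z2_def)
  have only: "a = x \<or> a = y" if "a > 0" "crown_F n a = 0" for a
    using that Z by (auto simp: crown_zeros_def)
  show "0 < crown_z1 n" "crown_z1 n < 1" "?R < crown_z2 n" using x y e by (auto simp: z)
  show "crown_F n a \<ge> 0" if "0 < a" "a \<le> crown_z1 n" for a
  proof (rule ccontr)
    assume neg: "\<not> crown_F n a \<ge> 0"
    obtain s where s: "0 < s" "s < a" "crown_F n s > 0" using small[OF \<open>0 < a\<close>] by auto
    obtain w where "s < w" "w < a" "crown_F n w = 0"
      using crown_F_sign_change[of n s a] s neg n by (auto simp: mult_pos_neg)
    then show False using only[of w] s that xy by (auto simp: z)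
  qed
  show "crown_F n a < 0" if "crown_z1 n < a" "a < crown_z2 n" for a
  proof (rule ccontr)
    assume "\<not> crown_F n a < 0"
    moreover have "crown_F n a \<noteq> 0" using only[of a] that x e by (auto simp: z)
    ultimately have pos: "crown_F n a > 0" by simp
    then have "a \<noteq> 1" using F1 by auto
    have a: "0 < a" using that x e by (auto simp: z)
    obtain w where w: "min a 1 < w" "w < max a 1" "crown_F n w = 0"
    proof (cases "a < 1")
      case True
      then show thesis
        using crown_F_sign_change[of n a 1] pos F1 a n that by (auto simp: mult_pos_neg min_def max_def)
    next
      case False
      then show thesis
        using crown_F_sign_change[of n 1 a] pos F1 a n that \<open>a \<noteq> 1\<close>
        by (auto simp: mult_neg_pos min_def max_def)
    qed
    have "1 < y" using y R by linarith
    then have "x < min a 1" "max a 1 < y" using that x by (simp_all add: z)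
    then have "x < w" "w < y" using w by linarith+
    then show False using only[of w] w(3) x e by auto
  qed
qed

text \<open>A convex radius \<open>a\<close> and its inverse both lie below \<open>z\<^sub>2\<close>. If one of them were at most \<open>z\<^sub>1\<close>, then
  \<open>F\<close> would be nonnegative there, while the other would lie between \<open>1\<close> and \<open>z\<^sub>2\<close>, where \<open>F\<close> is negative.\<close>
lemma admissible_convex_radius_central:
  assumes n: "n \<ge> 4" and card: "card (crown_zeros n) = 2"
    and a: "a \<in> admissible n" "a \<in> convex_radii n"
  shows "a \<in> central_admissible n"
proof -
  note Z = crown_zeros_two[OF n card]
  have c: "cos (pi / real n) > 0" using n by (intro cos_pi_over_pos) simp
  have a0: "a > 0" using a(2) c by (auto simp: convex_radii_def)
  have bounds: "a < crown_z2 n" "1 / a < crown_z2 n"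
  proof -
    show "a < crown_z2 n" using a(2) Z(3) by (simp add: convex_radii_def)
    have "1 / a < 1 / cos (pi / real n)"
      using a(2) c a0 by (intro divide_strict_left_mono) (auto simp: convex_radii_def)
    then show "1 / a < crown_z2 n" using Z(3) by simp
  qed
  have adm: "crown_F n a * crown_F n (1 / a) > 0 \<or> crown_F n a = 0 \<and> crown_F n (1 / a) = 0"
    using a(1) n by (subst (asm) admissible_iff) auto
  have "crown_z1 n < a"
  proof (rule ccontr)
    assume le: "\<not> crown_z1 n < a"
    then have "crown_F n a \<ge> 0" using Z(4)[of a] a0 by simp
    moreover have "1 < 1 / a" using le Z(2) a0 by simp
    then have "crown_F n (1 / a) < 0" using Z(5)[of "1 / a"] Z(2) bounds by simp
    ultimately show False using adm by (auto simp: zero_less_mult_iff)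
  qed
  moreover have "crown_z1 n < 1 / a"
  proof (rule ccontr)
    assume le: "\<not> crown_z1 n < 1 / a"
    then have "crown_F n (1 / a) \<ge> 0" using Z(4)[of "1 / a"] a0 by simp
    moreover have "1 < a" using le Z(2) a0 by (simp add: not_less field_simps) (metis less_le_trans mult.commute mult_less_cancel_left1 not_less order_less_irrefl less_trans le_less_trans)
    then have "crown_F n a < 0" using Z(5)[of a] Z(2) bounds by simp
    ultimately show False using adm by (auto simp: zero_less_mult_iff)
  qed
  then have "a < 1 / crown_z1 n" using a0 Z(1) by (simp add: field_simps)
  ultimately show ?thesis using n by (simp add: central_admissible_def)
qed

text \<open>This is what distinguishes \<open>n = 4\<close>: it places the smaller zero below the convex range, which is
  therefore admissible as a whole. The margin is small (the value is about \<open>- 0.04\<close>); dividing by \<open>sqrt 2\<close>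
  leaves the comparison of \<open>(2 * sqrt 2 + 1) / 8\<close> with \<open>2 / sqrt (5 / 2) ^ 3\<close>.\<close>
lemma crown_F_4_inner_bound_neg: "crown_F 4 (cos (pi / 4)) < 0"
proof -
  have c3: "cos (3 * pi / 4) = - (sqrt 2 / 2)" "sin (3 * pi / 4) = sqrt 2 / 2"
    using cos_pi_minus[of "pi / 4"] sin_pi_minus[of "pi / 4"] by (simp_all add: cos_45 sin_45 field_simps)
  have c57: "cos (5 * pi / 4) = - (sqrt 2 / 2)" "cos (7 * pi / 4) = sqrt 2 / 2"
  proof -
    have "5 * pi / 4 = 2 * pi - 3 * pi / 4" "7 * pi / 4 = 2 * pi - pi / 4" by simp_all
    then show "cos (5 * pi / 4) = - (sqrt 2 / 2)" "cos (7 * pi / 4) = sqrt 2 / 2"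
      by (simp_all only: cos_2pi_minus c3 cos_45)
  qed
  have S: "crown_S 4 = (2 * sqrt 2 + 1) / 4"
  proof -
    have "crown_S 4 = 1 / 4 * (1 / sin (pi / 4) + 1 / sin (pi / 2) + 1 / sin (3 * pi / 4))"
      by (simp add: crown_S_def eval_nat_numeral)
    then show ?thesis unfolding sin_45 c3 by (simp add: real_div_sqrt)
  qed
  have "crown_C21 4 (sqrt 2 / 2) = 2 * sqrt 2 / (5 / 2) powr (3 / 2)"
    by (simp add: crown_C21_def crown_angle_def eval_nat_numeral cos_45 c3 c57 power_divide)
  also have "(5 / 2 :: real) powr (3 / 2) = sqrt (5 / 2) ^ 3" by (intro powr_three_halves) simp
  finally have C: "crown_C21 4 (sqrt 2 / 2) = sqrt 2 * (2 / sqrt (5 / 2) ^ 3)" by simp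
  have "sqrt (5 / 2) \<le> 8 / 5" by (intro real_le_lsqrt) (simp_all add: power2_eq_square)
  then have "sqrt (5 / 2) ^ 3 \<le> (8 / 5) ^ 3" by (intro power_mono) auto
  then have "2 / (8 / 5) ^ 3 \<le> 2 / sqrt (5 / 2) ^ 3" by (intro divide_left_mono) auto
  moreover have "sqrt 2 \<le> 29 / 20" by (intro real_le_lsqrt) (simp_all add: power2_eq_square)
  ultimately have "(2 * sqrt 2 + 1) / 8 < 2 / sqrt (5 / 2) ^ 3" by (simp add: power3_eq_cube)
  then have "sqrt 2 * ((2 * sqrt 2 + 1) / 8) < sqrt 2 * (2 / sqrt (5 / 2) ^ 3)"
    by (intro mult_strict_left_mono) auto
  then show ?thesis by (simp add: crown_F_def cos_45 C S field_simps)
qed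

section \<open>Three bodies in each ring\<close>

lemma crown_F_3:
  assumes "a \<ge> 0"
  shows "crown_F 3 a = a / sqrt 3 - (2 * a - 1) / sqrt (1 - a + a\<^sup>2) ^ 3 - 1 / (1 + a)\<^sup>2"
proof -
  have s: "sin (2 * pi / 3) = sqrt 3 / 2" using sin_pi_minus[of "pi / 3"] by (simp add: sin_60 field_simps)
  have S: "crown_S 3 = 1 / sqrt 3"
  proof -
    have "crown_S 3 = 1 / 4 * (1 / sin (pi / 3) + 1 / sin (2 * pi / 3))"
      by (simp add: crown_S_def eval_nat_numeral)
    then show ?thesis unfolding sin_60 s by simp
  qed
  have c: "cos (5 * pi / 3) = 1 / 2" using cos_2pi_minus[of "pi / 3"] by (simp add: cos_60 field_simps)
  have u: "1 - a + a\<^sup>2 \<ge> 0"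
    using crown_denominator_nonneg[of a "pi / 3"] by (simp add: cos_60)
  have "(1 + a\<^sup>2 + 2 * a) powr (3 / 2) = sqrt ((1 + a)\<^sup>2) ^ 3"
    using assms by (subst powr_three_halves) (auto simp: power2_eq_square algebra_simps)
  then have p: "(1 + a\<^sup>2 + 2 * a) powr (3 / 2) = (1 + a) ^ 3" using assms by simp
  have q: "(1 + a\<^sup>2 - a) powr (3 / 2) = sqrt (1 - a + a\<^sup>2) ^ 3"
    using powr_three_halves[OF u] by (simp add: algebra_simps)
  have "crown_C21 3 a = 2 * ((a - 1 / 2) / (1 + a\<^sup>2 - a) powr (3 / 2)) + (a + 1) / (1 + a\<^sup>2 + 2 * a) powr (3 / 2)"
    by (simp add: crown_C21_def crown_angle_def eval_nat_numeral cos_60 c)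
  also have "(a + 1) / (1 + a\<^sup>2 + 2 * a) powr (3 / 2) = 1 / (1 + a)\<^sup>2"
    unfolding p using assms by (simp add: power2_eq_square power3_eq_cube add.commute)
  also have "2 * ((a - 1 / 2) / (1 + a\<^sup>2 - a) powr (3 / 2)) = (2 * a - 1) / sqrt (1 - a + a\<^sup>2) ^ 3"
    unfolding q times_divide_eq_right by (simp add: right_diff_distrib)
  finally show ?thesis by (simp add: crown_F_def S)
qed

text \<open>Isolating the square root in \<open>F a = 0\<close> and squaring gives a polynomial equation, which is nontrivial
  because the polynomial is \<open>27\<close> at \<open>- 1\<close>. Finiteness makes \<open>crown_z2 3\<close>, a maximum over the set of
  zeros, meaningful.\<close>
lemma finite_crown_zeros_3: "finite (crown_zeros 3)"
proof -
  define p :: "real poly" where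
    "p = ([:0, 1 / sqrt 3:] * [:1, 1:]\<^sup>2 - 1)\<^sup>2 * [:1, - 1, 1:] ^ 3 - [:- 1, 2:]\<^sup>2 * [:1, 1:] ^ 4"
  have poly: "poly p x = (x / sqrt 3 * (1 + x)\<^sup>2 - 1)\<^sup>2 * (1 - x + x\<^sup>2) ^ 3 - (2 * x - 1)\<^sup>2 * (1 + x) ^ 4" for x
    by (simp add: p_def power2_eq_square algebra_simps)
  \<comment> \<open>At \<open>- 1\<close> every summand with a factor \<open>1 + x\<close> vanishes.\<close>
  have "poly p (- 1) \<noteq> 0" unfolding poly by simp
  then have "p \<noteq> 0" by auto
  then have "finite {x. poly p x = 0}" by (rule poly_roots_finite)
  moreover have "crown_zeros 3 \<subseteq> {x. poly p x = 0}"
  proof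
    fix a assume "a \<in> crown_zeros 3"
    then have a: "a > 0" "crown_F 3 a = 0" by (auto simp: crown_zeros_def)
    define u q D where "u = 1 - a + a\<^sup>2" and "q = (1 + a)\<^sup>2" and "D = sqrt u"
    have "u = (a - 1 / 2)\<^sup>2 + 3 / 4" by (simp add: u_def power2_eq_square algebra_simps)
    then have "u > 0" by (simp add: add_nonneg_pos)
    then have D: "D > 0" "D\<^sup>2 = u" by (auto simp: D_def)
    have q: "q > 0" using a by (simp add: q_def)
    have "a / sqrt 3 - 1 / q = (2 * a - 1) / D ^ 3"
      using a crown_F_3[of a] by (simp add: u_def D_def q_def)
    then have "(a / sqrt 3 * q - 1) * D ^ 3 = (2 * a - 1) * q"
      using D q by (simp add: field_simps)
    then have "((a / sqrt 3 * q - 1) * D ^ 3)\<^sup>2 = ((2 * a - 1) * q)\<^sup>2" by simp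
    moreover have "((a / sqrt 3 * q - 1) * D ^ 3)\<^sup>2 = (a / sqrt 3 * q - 1)\<^sup>2 * u ^ 3"
      unfolding D(2)[symmetric] by (simp add: power_mult_distrib flip: power_mult)
    moreover have "((2 * a - 1) * q)\<^sup>2 = (2 * a - 1)\<^sup>2 * (1 + a) ^ 4"
      by (simp add: q_def power_mult_distrib flip: power_mult)
    ultimately show "a \<in> {x. poly p x = 0}" unfolding mem_Collect_eq poly u_def q_def by simp
  qed
  ultimately show ?thesis by (rule finite_subset[rotated])
qed

text \<open>On this range \<open>u \<le> 1\<close>, so the root in the denominator may be dropped, and \<open>sqrt 3 \<ge> 5 / 3\<close> turns
  the claim into the positivity of a quadratic polynomial.\<close>
lemma crown_F_3_neg:
  assumes "1 / 2 \<le> a" "a \<le> 1"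
  shows "crown_F 3 a < 0"
proof -
  define u where "u = 1 - a + a\<^sup>2"
  have "1 - u = a * (1 - a)" by (simp add: u_def power2_eq_square algebra_simps)
  also have "\<dots> \<ge> 0" using assms by simp
  finally have "sqrt u \<le> 1" by simp
  have "u = (a - 1 / 2)\<^sup>2 + 3 / 4" by (simp add: u_def power2_eq_square algebra_simps)
  then have "u > 0" by (simp add: add_nonneg_pos)
  then have u: "0 < sqrt u ^ 3" "sqrt u ^ 3 \<le> 1" using \<open>sqrt u \<le> 1\<close> by (auto intro: power_le_one)
  define X where "X = (2 * a - 1) / sqrt u ^ 3"
  have "(2 * a - 1) / 1 \<le> X"
    unfolding X_def using u assms by (intro divide_left_mono) auto
  then have "2 * a - 1 \<le> X" by simp
  moreover have "a / sqrt 3 \<le> a / (5 / 3)"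
    using assms by (intro divide_left_mono real_le_rsqrt) (auto simp: power2_eq_square)
  then have "a / sqrt 3 \<le> 3 / 5 * a" by simp
  moreover have "3 / 5 * a - (2 * a - 1) < 1 / (1 + a)\<^sup>2"
  proof -
    have "0 \<le> a * a" by simp
    then have "0 < 7 / 5 * (a * a) + 9 / 5 * a - 3 / 5" using assms by linarith
    then have "0 < a * (7 / 5 * (a * a) + 9 / 5 * a - 3 / 5)"
      using assms by (intro mult_pos_pos) auto
    then have "(1 - 7 / 5 * a) * (1 + a)\<^sup>2 < 1" by (simp add: power2_eq_square algebra_simps)
    then show ?thesis using assms by (simp add: less_divide_eq)
  qed
  moreover have "crown_F 3 a = a / sqrt 3 - X - 1 / (1 + a)\<^sup>2"
    using crown_F_3[of a] assms by (simp add: X_def u_def)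
  ultimately show ?thesis by linarith
qed

text \<open>\<open>F x / x\<close> is a constant minus decreasing terms. The quotient \<open>(2 * x - 1) / (x * u powr (3 / 2))\<close> is
  split into \<open>(2 * x - 1) / x\<^sup>2 = 1 - (1 - 1 / x)\<^sup>2\<close>, \<open>x / u = 1 / (x + 1 / x - 1)\<close> and \<open>1 / sqrt u\<close>,
  each nonnegative and decreasing for \<open>x \<ge> 1\<close>.\<close>
lemma crown_F_3_over_radius_strict_mono:
  assumes "1 \<le> a" "a < b"
  shows "crown_F 3 a / a < crown_F 3 b / b"
proof -
  define u where "u x = 1 - x + x\<^sup>2" for x :: real
  have u_pos: "u x > 0" for x
  proof -
    have "u x = (x - 1 / 2)\<^sup>2 + 3 / 4" by (simp add: u_def power2_eq_square algebra_simps)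
    then show ?thesis by (simp add: add_nonneg_pos)
  qed
  have F: "crown_F 3 x / x = 1 / sqrt 3 - (2 * x - 1) / x\<^sup>2 * (x / u x) * (1 / sqrt (u x)) - 1 / (x * (1 + x)\<^sup>2)"
    if "x > 0" for x
  proof -
    have "sqrt (u x) ^ 3 = u x * sqrt (u x)" using u_pos[of x] by (simp add: power3_eq_cube)
    then have eq: "crown_F 3 x = x / sqrt 3 - (2 * x - 1) / (u x * sqrt (u x)) - 1 / (1 + x)\<^sup>2"
      using that crown_F_3[of x] by (simp add: u_def[symmetric])
    have parts: "(A - B - C) / x = A / x - B / x - C / x" for A B C :: real
      by (simp add: diff_divide_distrib)
    have "x / sqrt 3 / x = 1 / sqrt 3" using that by simp
    moreover have "(2 * x - 1) / (u x * sqrt (u x)) / x = (2 * x - 1) / x\<^sup>2 * (x / u x) * (1 / sqrt (u x))"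
      using that u_pos[of x] by (simp add: power2_eq_square)
    moreover have "1 / (1 + x)\<^sup>2 / x = 1 / (x * (1 + x)\<^sup>2)" by (simp add: mult.commute)
    ultimately show ?thesis unfolding eq parts by (simp only:)
  qed
  have ab: "a * b \<ge> a" "a * b \<ge> b" "a > 0" "b > 0" using assms by auto
  have "(b - a) * (2 * (a * b) - a - b) \<ge> 0" using assms ab by (intro mult_nonneg_nonneg) linarith+
  then have "(2 * b - 1) * a\<^sup>2 \<le> (2 * a - 1) * b\<^sup>2" by (simp add: power2_eq_square algebra_simps)
  then have 1: "(2 * b - 1) / b\<^sup>2 \<le> (2 * a - 1) / a\<^sup>2" using ab by (simp add: frac_le_eq divide_le_eq field_simps)
  have "(b - a) * (a * b - 1) \<ge> 0" using assms ab by (intro mult_nonneg_nonneg) linarith+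
  then have "b * u a \<le> a * u b" by (simp add: u_def power2_eq_square algebra_simps)
  then have 2: "b / u b \<le> a / u a" using u_pos[of a] u_pos[of b] by (simp add: field_simps)
  have "(b - a) * (a + b - 1) \<ge> 0" using assms by (intro mult_nonneg_nonneg) linarith+
  then have "u a \<le> u b" by (simp add: u_def power2_eq_square algebra_simps)
  then have 3: "1 / sqrt (u b) \<le> 1 / sqrt (u a)" using u_pos[of a] by (intro divide_left_mono) auto
  have "(2 * b - 1) / b\<^sup>2 * (b / u b) * (1 / sqrt (u b)) \<le> (2 * a - 1) / a\<^sup>2 * (a / u a) * (1 / sqrt (u a))"
    using assms u_pos[of a] u_pos[of b] less_imp_le[OF u_pos[of a]] less_imp_le[OF u_pos[of b]]
    by (intro mult_mono[OF mult_mono[OF 1 2] 3]) auto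
  moreover have "a * (1 + a)\<^sup>2 < b * (1 + b)\<^sup>2"
    using assms by (intro mult_strict_mono power_strict_mono) auto
  then have "1 / (b * (1 + b)\<^sup>2) < 1 / (a * (1 + a)\<^sup>2)"
    using ab by (intro divide_strict_left_mono) auto
  ultimately show ?thesis using F[of a] F[of b] ab by linarith
qed

text \<open>\<open>F\<close> is negative on \<open>[1/2, 1]\<close> and positive at \<open>2\<close>, and \<open>F x / x\<close> increases from \<open>1\<close> on. So there is
  exactly one zero above \<open>1 / 2\<close>; it is the largest zero, and it lies inside the convex range.\<close>
lemma crown_z2_3:
  shows "1 < crown_z2 3" "crown_z2 3 < 2"
    and "\<And>a. 1 / 2 \<le> a \<Longrightarrow> a < crown_z2 3 \<Longrightarrow> crown_F 3 a < 0"
    and "\<And>a. crown_z2 3 < a \<Longrightarrow> crown_F 3 a > 0"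
    and "crown_F 3 (crown_z2 3) = 0"
proof -
  have "crown_F 3 2 = 2 / sqrt 3 - 3 / sqrt 3 ^ 3 - 1 / 9" by (simp add: crown_F_3)
  also have "3 / sqrt 3 ^ 3 = 1 / sqrt 3" by (simp add: power3_eq_cube)
  finally have "crown_F 3 2 = 1 / sqrt 3 - 1 / 9" by (simp add: field_simps)
  moreover have "1 / 9 < 1 / sqrt 3"
    by (intro divide_strict_left_mono real_less_lsqrt) (auto simp: power2_eq_square)
  ultimately have "crown_F 3 2 > 0" by simp
  moreover have F1: "crown_F 3 1 < 0" by (intro crown_F_3_neg) auto
  ultimately obtain z where z: "1 < z" "z < 2" "crown_F 3 z = 0"
    using crown_F_sign_change[of 3 1 2] by (auto simp: mult_neg_pos)
  have neg: "crown_F 3 a < 0" if "1 / 2 \<le> a" "a < z" for a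
  proof (cases "a \<le> 1")
    case True
    then show ?thesis using that by (intro crown_F_3_neg)
  next
    case False
    then have "crown_F 3 a / a < crown_F 3 z / z"
      using that by (intro crown_F_3_over_radius_strict_mono) auto
    then show ?thesis using False z by (simp add: divide_less_0_iff)
  qed
  have pos: "crown_F 3 a > 0" if "z < a" for a
  proof -
    have "crown_F 3 z / z < crown_F 3 a / a"
      using that z by (intro crown_F_3_over_radius_strict_mono) auto
    then show ?thesis using that z by (simp add: zero_less_divide_iff)
  qed
  have "crown_z2 3 = z"
    unfolding crown_z2_def
  proof (rule Max_eqI[OF finite_crown_zeros_3])
    show "z \<in> crown_zeros 3" using z by (simp add: crown_zeros_def)
    show "y \<le> z" if "y \<in> crown_zeros 3" for y
      using that pos[of y] by (force simp: crown_zeros_def)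
  qed
  then show "1 < crown_z2 3" "crown_z2 3 < 2" "crown_F 3 (crown_z2 3) = 0"
    "\<And>a. 1 / 2 \<le> a \<Longrightarrow> a < crown_z2 3 \<Longrightarrow> crown_F 3 a < 0"
    "\<And>a. crown_z2 3 < a \<Longrightarrow> crown_F 3 a > 0"
    using z neg pos by auto
qed

text \<open>Inside the convex range \<open>(1/2, 2)\<close>, \<open>F\<close> is negative exactly below \<open>z\<^sub>2\<close>. Since \<open>a\<close> and \<open>1 / a\<close> are
  not both greater than \<open>1\<close>, the signs at \<open>a\<close> and \<open>1 / a\<close> can only agree by both being negative.\<close>
lemma admissible_convex_radii_3: "admissible 3 \<inter> convex_radii 3 = central_admissible 3"
proof -
  note Z = crown_z2_3
  have C: "convex_radii 3 = {1 / 2 <..< 2}" by (simp add: convex_radii_def cos_60)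
  have A: "central_admissible 3 = {1 / crown_z2 3 <..< crown_z2 3}" by (simp add: central_admissible_def)
  have z: "1 / 2 < 1 / crown_z2 3" "1 / crown_z2 3 < 1"
    using Z(1,2) by (auto simp: field_simps)
  show ?thesis
  proof (intro set_eqI iffI)
    fix a assume a: "a \<in> admissible 3 \<inter> convex_radii 3"
    then have a12: "1 / 2 < a" "a < 2" by (auto simp: C)
    then have i12: "1 / 2 < 1 / a" "1 / a < 2" by (auto simp: field_simps)
    have adm: "crown_F 3 a * crown_F 3 (1 / a) > 0 \<or> crown_F 3 a = 0 \<and> crown_F 3 (1 / a) = 0"
      using a admissible_iff[of 3 a] by auto
    have "a < crown_z2 3"
    proof (rule ccontr)
      assume ge: "\<not> a < crown_z2 3"
      then have "crown_F 3 a \<ge> 0" using Z(4)[of a] Z(5) by (cases "a = crown_z2 3") auto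
      moreover have "1 / a < 1" using ge Z(1) by simp
      then have "crown_F 3 (1 / a) < 0" using Z(1) i12 by (intro Z(3)) auto
      ultimately show False using adm by (auto simp: zero_less_mult_iff)
    qed
    moreover have "1 / a < crown_z2 3"
    proof (rule ccontr)
      assume ge: "\<not> 1 / a < crown_z2 3"
      then have "crown_F 3 (1 / a) \<ge> 0" using Z(4)[of "1 / a"] Z(5) by (cases "1 / a = crown_z2 3") auto
      moreover have "1 < 1 / a" using ge Z(1) by linarith
      then have "a < 1" using a12 by simp
      then have "crown_F 3 a < 0" using Z(1) a12 by (intro Z(3)) auto
      ultimately show False using adm by (auto simp: zero_less_mult_iff)
    qed
    ultimately show "a \<in> central_admissible 3" using a12 Z(1) by (simp add: A field_simps)
  next
    fix a assume "a \<in> central_admissible 3"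
    then have a: "1 / crown_z2 3 < a" "a < crown_z2 3" by (auto simp: A)
    then have a12: "1 / 2 < a" "a < 2" using z Z(2) by linarith+
    have i: "1 / 2 \<le> 1 / a" "1 / a < crown_z2 3"
      using a a12 Z(1) by (auto simp: field_simps)
    have "crown_F 3 a < 0" using a a12 by (intro Z(3)) auto
    moreover have "crown_F 3 (1 / a) < 0" using i by (intro Z(3)) auto
    ultimately have "a \<in> admissible 3" using a12 by (subst admissible_iff) (auto simp: mult_neg_neg)
    then show "a \<in> admissible 3 \<inter> convex_radii 3" using a12 by (simp add: C)
  qed
qed

section \<open>Convexity and the central admissible interval\<close>

lemma twisted_crown_imp_admissible: "twisted_crown n a m \<Longrightarrow> a \<in> admissible n"
  by (auto simp: admissible_def twisted_crown_def)

theorem proposition3: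
  fixes n :: nat
  assumes "n \<ge> 3"
    and "n \<ge> 4 \<Longrightarrow> card (crown_zeros n) = 2"
  shows "(n = 3 \<longrightarrow>
            admissible n \<inter> convex_radii n = central_admissible n \<and>
            (\<forall>a m. twisted_crown n a m \<longrightarrow>
               (convex_configuration (2 * n) (crown_position n a) \<longleftrightarrow>
                a \<in> central_admissible n))) \<and>
         (n = 4 \<longrightarrow>
            admissible n \<inter> convex_radii n = convex_radii n \<and>
            (\<forall>a m. twisted_crown n a m \<and>
               convex_configuration (2 * n) (crown_position n a) \<longrightarrow>
               a \<in> central_admissible n) \<and>
            (\<exists>a \<in> central_admissible n.
               \<not> convex_configuration (2 * n) (crown_position n a))) \<and>
         (n \<ge> 5 \<longrightarrow>
            (\<forall>a m. twisted_crown n a m \<and>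
               convex_configuration (2 * n) (crown_position n a) \<longrightarrow>
               a \<in> central_admissible n))"
proof -
  have convex: "convex_configuration (2 * n) (crown_position n a) \<longleftrightarrow> a \<in> convex_radii n"
    if "twisted_crown n a m" for a m
    using that assms(1) by (intro convex_configuration_crown_iff) (auto simp: twisted_crown_def)
  have central: "a \<in> central_admissible n"
    if "n \<ge> 4" "twisted_crown n a m \<and> convex_configuration (2 * n) (crown_position n a)" for a m
    using that assms(2) convex twisted_crown_imp_admissible
    by (intro admissible_convex_radius_central) auto
  have three: "admissible n \<inter> convex_radii n = central_admissible n \<and>
      (\<forall>a m. twisted_crown n a m \<longrightarrow>
        (convex_configuration (2 * n) (crown_position n a) \<longleftrightarrow> a \<in> central_admissible n))" if "n = 3"
    using admissible_convex_radii_3 convex twisted_crown_imp_admissible that by blast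
  have four: "admissible n \<inter> convex_radii n = convex_radii n \<and>
      (\<exists>a \<in> central_admissible n. \<not> convex_configuration (2 * n) (crown_position n a))" if n: "n = 4"
  proof -
    note Z = crown_zeros_two[of n, OF _ assms(2)]
    let ?c = "cos (pi / real n)"
    have c: "0 < ?c" "?c < 1" using cos_pi_over_pos[of n] cos_pi_over_less_1[of n] n by auto
    have z1: "crown_z1 n < ?c"
      using Z(4)[of ?c] crown_F_4_inner_bound_neg c n by force
    have neg: "crown_F n a < 0" if "?c < a" "a < 1 / ?c" for a
      using that z1 Z(3) n by (intro Z(5)) auto
    have "a \<in> admissible n" if a: "a \<in> convex_radii n" for a
    proof -
      have a': "?c < a" "a < 1 / ?c" "a > 0" using a c by (auto simp: convex_radii_def)
      then have "?c < 1 / a" "1 / a < 1 / ?c" using c by (auto simp: field_simps)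
      then have "crown_F n a * crown_F n (1 / a) > 0" using neg a' by (intro mult_neg_neg) auto
      then show ?thesis using a' n by (subst admissible_iff) auto
    qed
    moreover have "?c \<in> central_admissible n"
    proof -
      have "?c * crown_z1 n < 1 * 1" using c Z(1,2) n by (intro mult_strict_mono) auto
      then show ?thesis using z1 Z(1) n by (simp add: central_admissible_def field_simps)
    qed
    moreover have "\<not> convex_configuration (2 * n) (crown_position n ?c)"
      using convex_configuration_crown_iff[of n ?c] c n by (simp add: convex_radii_def)
    ultimately show ?thesis by blast
  qed
  show ?thesis using three four central by auto
qed

end
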